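(* Let $(E,\Phi)$ be a $t$-module over $K$ of dimension $d$, and let \[ \Phi_t=A_0+A_1\tau+\ldots +A_s\tau^s \in \mathrm{Mat}_{d\times d}(K\{\tau\}) \] with respect to some isomorphism $E\cong \mathbb{G}_a^d$. Let $k\ge0$. Then the $k$-th prolongation $(\rho_kE,\rho_k\Phi)$ of $(E,\Phi)$ is of dimension $d(k+1)$ and (with respect to a suitable isomorphism $\rho_kE\cong\mathbb{G}_a^{d(k+1)}$) $(\rho_k\Phi)_t$ is given in block form as \[ (\rho_k\Phi)_t= \begin{pmatrix} A_0 & 0 & \cdots &\cdots & 0 \\ -\mathbf{1}_d & \ddots & \ddots && \vdots \\ 0 & \ddots & \ddots & \ddots& \vdots \\ \vdots & \ddots & \ddots & \ddots& 0\\ 0&\cdots &0 & -\mathbf{1}_d & A_0 \end{pmatrix}+ \mathrm{diag}(A_1)\tau+\ldots + \mathrm{diag}(A_s)\tau^s, \] where $\mathbf{1}_d$ is the $(d\times d)$-identity matrix, and $\mathrm{diag}(A_i)$ is the block diagonal matrix with $k+1$ diagonal blocks all equal to $A_i$, for $i=1,\ldots, s$.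
   Context: Let $K$ be a finite extension of $\mathbb{F}_q(\theta)$. For $a=\sum x_it^i\in K[t]$ put $a^\tau=\sum x_i^qt^i$; $K[t]\{\tau\}$ is the skew polynomial ring with $\tau a=a^\tau\tau$, and $K\{\tau\}$ the corresponding skew polynomial ring over $K$, identified with the ring of $\mathbb{F}_q$-linear group endomorphisms of $\mathbb{G}_{a,K}$ ($\tau$ = $q$-power Frobenius). A $t$-module $(E,\Phi)$ of dimension $d$ over $K$ is an algebraic group $E$ over $K$ (with $\mathbb{F}_q$-action) isomorphic to $\mathbb{G}_a^d$ with an $\mathbb{F}_q$-algebra homomorphism $\Phi:\mathbb{F}_q[t]\to\mathrm{End}_{\mathrm{grp},\mathbb{F}_q}(E)\cong\mathrm{Mat}_{d\times d}(K\{\tau\})$, $f\mapsto\Phi_f$, such that, writing $\Phi_t=A_0+A_1\tau+\dots+A_s\tau^s$ with $A_i\in\mathrm{Mat}_{d\times d}(K)$, the matrix $A_0-\theta\mathbf 1_d$ is nilpotent. Matrices act on column vectors. A $t$-motive is a left $K[t]\{\tau\}$-module $\mathsf{M}$ that is free and finitely generated over $K\{\tau\}$ with $(t-\theta)^\ell\mathsf{M}\subseteq K[t]\cdot\tau(\mathsf{M})$ for some $\ell\in\mathbb{N}$. To a $t$-module $E$ one associates the $t$-motive $\mathsf{E}=\mathrm{Hom}_{\mathrm{grp},\mathbb{F}_q}(E,\mathbb{G}_a)$, with $t$ acting by $m\mapsto m\circ\Phi_t$ and $K\{\tau\}=\mathrm{End}_{\mathrm{grp},\mathbb{F}_q}(\mathbb{G}_a)$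 acting by composition on the left. This is an anti-equivalence of categories between $t$-modules and $t$-motives (Anderson), so each $t$-motive has an associated $t$-module, unique up to isomorphism. Prolongation of $t$-motives: $\rho_k\mathsf{M}$ is the $K[t]$-module generated by symbols $D_im$ ($i=0,\dots,k$, $m\in\mathsf{M}$) subject to $D_i(m_1+m_2)=D_im_1+D_im_2$ and $D_i(am)=\sum_{i_1+i_2=i}\partial_t^{(i_1)}(a)\cdot D_{i_2}m$ for $m,m_1,m_2\in\mathsf{M}$, $a\in K[t]$, where $\partial_t^{(n)}$ is $K$-linear with $\partial_t^{(n)}(t^i)=\binom{i}{n}t^{i-n}$; the $\tau$-action is $\tau(a\cdot D_im)=a^\tau\cdot D_i(\tau(m))$. It is again a $t$-motive. Prolongation of $t$-modules: $(\rho_kE,\rho_k\Phi)$ is the $t$-module associated to $\rho_k\mathsf{E}$, where $\mathsf{E}$ is the $t$-motive of $(E,\Phi)$. *)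

theory Defs
  imports
    "Jordan_Normal_Form.Matrix"
    "HOL-Library.Poly_Mapping"
    "HOL-Library.FuncSet"
    "HOL-Library.Cardinality"
    "HOL-Computational_Algebra.Computational_Algebra"
begin

section \<open>The base field\<close>

text \<open>
  The finite field is the type 'q, so that q = CARD('q), its rational function field is
  'q poly fract, and K = 'k is given together with the embedding j of the rational function field.
\<close>

definition finite_extension ::
  "('q::{finite,field} poly fract \<Rightarrow> 'k::field) \<Rightarrow> bool" where
  "finite_extension j \<longleftrightarrow>
     field_hom j \<and> (\<exists>B. finite B \<and> module.span (\<lambda>c x. j c * x) B = UNIV)"

definition theta :: "('q::{finite,field} poly fract \<Rightarrow> 'k::field) \<Rightarrow> 'k" where
  "theta j = j (Fraction_Field.Fract [:0, 1:] 1)"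

definition fq_emb :: "('q::{finite,field} poly fract \<Rightarrow> 'k::field) \<Rightarrow> 'q \<Rightarrow> 'k" where
  "fq_emb j c = j (Fraction_Field.Fract [:c:] 1)"


section \<open>Algebraic groups isomorphic to a power of the additive group\<close>

text \<open>
  An algebraic group over K with an action of the finite field is given by its set of K-rational
  points and its ring of regular functions, the latter as functions on K-rational points. For
  groups isomorphic over K to a power of the additive group nothing is lost, since K is infinite:
  a polynomial is determined by its values at K-rational points. Functions on the points are
  represented by functions on the whole type that are undefined elsewhere.

  No group axioms are imposed; they follow from the existence of an isomorphism (below) to a
  power of the additive group.
\<close>

record ('q, 'k, 'e) alg_group =
  points :: "'e set"
  gadd :: "'e \<Rightarrow> 'e \<Rightarrow> 'e"
  fq_act :: "'q \<Rightarrow> 'e \<Rightarrow> 'e"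
  regular :: "('e \<Rightarrow> 'k) set"

definition alg_hom ::
  "('q, 'k, 'e) alg_group \<Rightarrow> ('q, 'k, 'f) alg_group \<Rightarrow> ('e \<Rightarrow> 'f) \<Rightarrow> bool" where
  "alg_hom E F \<phi> \<longleftrightarrow>
     \<phi> \<in> points E \<rightarrow> points F \<and>
     (\<forall>x\<in>points E. \<forall>y\<in>points E. \<phi> (gadd E x y) = gadd F (\<phi> x) (\<phi> y)) \<and>
     (\<forall>c. \<forall>x\<in>points E. \<phi> (fq_act E c x) = fq_act F c (\<phi> x)) \<and>
     (\<forall>f\<in>regular F. restrict (f \<circ> \<phi>) (points E) \<in> regular E)"

definition alg_iso ::
  "('q, 'k, 'e) alg_group \<Rightarrow> ('q, 'k, 'f) alg_group \<Rightarrow> ('e \<Rightarrow> 'f) \<Rightarrow> bool" where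
  "alg_iso E F \<phi> \<longleftrightarrow>
     alg_hom E F \<phi> \<and> bij_betw \<phi> (points E) (points F) \<and>
     alg_hom F E (inv_into (points E) \<phi>)"

inductive_set poly_funs :: "nat \<Rightarrow> ('k::field vec \<Rightarrow> 'k) set" for d where
  const: "(\<lambda>_. c) \<in> poly_funs d"
| coord: "i < d \<Longrightarrow> (\<lambda>x. x $ i) \<in> poly_funs d"
| add: "f \<in> poly_funs d \<Longrightarrow> g \<in> poly_funs d \<Longrightarrow> (\<lambda>x. f x + g x) \<in> poly_funs d"
| mult: "f \<in> poly_funs d \<Longrightarrow> g \<in> poly_funs d \<Longrightarrow> (\<lambda>x. f x * g x) \<in> poly_funs d"

definition Ga ::
  "('q::{finite,field} poly fract \<Rightarrow> 'k::field) \<Rightarrow> nat \<Rightarrow> ('q, 'k, 'k vec) alg_group" where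
  "Ga j d =
     \<lparr>points = carrier_vec d,
      gadd = (+),
      fq_act = (\<lambda>c x. fq_emb j c \<cdot>\<^sub>v x),
      regular = (\<lambda>f. restrict f (carrier_vec d)) ` poly_funs d\<rparr>"

text \<open>
  Homomorphisms from E to the additive group itself, with target K rather than the
  one-dimensional vectors.
\<close>

definition hom_Ga ::
  "('q::{finite,field} poly fract \<Rightarrow> 'k::field) \<Rightarrow> ('q, 'k, 'e) alg_group \<Rightarrow> ('e \<Rightarrow> 'k) set" where
  "hom_Ga j E =
     {f \<in> regular E.
        (\<forall>x\<in>points E. \<forall>y\<in>points E. f (gadd E x y) = f x + f y) \<and>
        (\<forall>c. \<forall>x\<in>points E. f (fq_act E c x) = fq_emb j c * f x)}"


section \<open>t-modules\<close>

text \<open>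
  The endomorphism of the d-th power of the additive group given by the matrix
  A 0 + A 1 \<tau> + ... + A s \<tau>^s of skew polynomials.
\<close>

definition skew_mat_apply :: "nat \<Rightarrow> nat \<Rightarrow> nat \<Rightarrow> (nat \<Rightarrow> 'k::field mat) \<Rightarrow> 'k vec \<Rightarrow> 'k vec" where
  "skew_mat_apply q d s A x =
     vec d (\<lambda>r. \<Sum>i\<le>s. (A i *\<^sub>v map_vec (\<lambda>c. c ^ (q ^ i)) x) $ r)"

definition has_skew_matrix ::
  "('q::{finite,field}, 'k::field, 'e) alg_group \<Rightarrow> nat \<Rightarrow> ('e \<Rightarrow> 'k vec) \<Rightarrow> ('e \<Rightarrow> 'e) \<Rightarrow>
   nat \<Rightarrow> (nat \<Rightarrow> 'k mat) \<Rightarrow> bool" where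
  "has_skew_matrix E d \<kappa> \<phi> s A \<longleftrightarrow>
     (\<forall>i\<le>s. A i \<in> carrier_mat d d) \<and>
     (\<forall>x\<in>points E. \<kappa> (\<phi> x) = skew_mat_apply CARD('q) d s A (\<kappa> x))"

abbreviation t_var :: "'q::{finite,field} poly" where
  "t_var \<equiv> [:0, 1:]"

definition t_module ::
  "('q::{finite,field} poly fract \<Rightarrow> 'k::field) \<Rightarrow> nat \<Rightarrow> ('q, 'k, 'e) alg_group \<Rightarrow>
   ('q poly \<Rightarrow> 'e \<Rightarrow> 'e) \<Rightarrow> bool" where
  "t_module j d E \<Phi> \<longleftrightarrow>
     regular E \<subseteq> extensional (points E) \<and>
     (\<forall>f. alg_hom E E (\<Phi> f)) \<and>
     (\<forall>x\<in>points E.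
        \<Phi> 1 x = x \<and>
        (\<forall>f g. \<Phi> (f + g) x = gadd E (\<Phi> f x) (\<Phi> g x)) \<and>
        (\<forall>f g. \<Phi> (f * g) x = \<Phi> f (\<Phi> g x)) \<and>
        (\<forall>c f. \<Phi> (smult c f) x = fq_act E c (\<Phi> f x))) \<and>
     (\<exists>\<kappa> s A. alg_iso E (Ga j d) \<kappa> \<and> has_skew_matrix E d \<kappa> (\<Phi> t_var) s A \<and>
        (\<exists>n. (A 0 - theta j \<cdot>\<^sub>m 1\<^sub>m d) ^\<^sub>m n = 0\<^sub>m d d))"


section \<open>The motive of a t-module\<close>

text \<open>
  A left module over the skew polynomial ring over K[t] is a K[t]-module with an additive
  operator \<tau> that is semilinear for the twist of K[t].
\<close>

record (overloaded) ('k, 'm) skew_module =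
  mcarrier :: "'m set"
  madd :: "'m \<Rightarrow> 'm \<Rightarrow> 'm"
  mscale :: "'k poly \<Rightarrow> 'm \<Rightarrow> 'm"
  mtau :: "'m \<Rightarrow> 'm"

definition skew_module_iso ::
  "('k::zero, 'm) skew_module \<Rightarrow> ('k, 'n) skew_module \<Rightarrow> ('m \<Rightarrow> 'n) \<Rightarrow> bool" where
  "skew_module_iso M N h \<longleftrightarrow>
     bij_betw h (mcarrier M) (mcarrier N) \<and>
     (\<forall>x\<in>mcarrier M. \<forall>y\<in>mcarrier M. h (madd M x y) = madd N (h x) (h y)) \<and>
     (\<forall>a. \<forall>x\<in>mcarrier M. h (mscale M a x) = mscale N a (h x)) \<and>
     (\<forall>x\<in>mcarrier M. h (mtau M x) = mtau N (h x))"

definition motive ::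
  "('q::{finite,field} poly fract \<Rightarrow> 'k::field) \<Rightarrow> ('q, 'k, 'e) alg_group \<Rightarrow>
   ('q poly \<Rightarrow> 'e \<Rightarrow> 'e) \<Rightarrow> ('k, 'e \<Rightarrow> 'k) skew_module" where
  "motive j E \<Phi> =
     \<lparr>mcarrier = hom_Ga j E,
      madd = (\<lambda>m n. restrict (\<lambda>x. m x + n x) (points E)),
      mscale = (\<lambda>a m. restrict
        (\<lambda>x. \<Sum>i\<le>degree a. coeff a i * m ((\<Phi> t_var ^^ i) x)) (points E)),
      mtau = (\<lambda>m. restrict (\<lambda>x. m x ^ CARD('q)) (points E))\<rparr>"


section \<open>Prolongation\<close>

definition twist :: "nat \<Rightarrow> 'k::field poly \<Rightarrow> 'k poly" where
  "twist q a = map_poly (\<lambda>c. c ^ q) a"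

text \<open>The truncated subtraction is harmless: the binomial coefficient vanishes for i < n.\<close>

definition hyperderiv :: "nat \<Rightarrow> 'k::field poly \<Rightarrow> 'k poly" where
  "hyperderiv n a = (\<Sum>i\<le>degree a. monom (coeff a i * of_nat (i choose n)) (i - n))"

text \<open>
  The free K[t]-module on symbols D i m sits inside the finitely supported functions from
  pairs (i, m) to K[t]; the prolongation is its quotient by the span of the relations.
\<close>

definition D :: "nat \<Rightarrow> 'm \<Rightarrow> (nat \<times> 'm) \<Rightarrow>\<^sub>0 'k::field poly" where
  "D i m = Poly_Mapping.single (i, m) 1"

definition fscale ::
  "'k::field poly \<Rightarrow> ((nat \<times> 'm) \<Rightarrow>\<^sub>0 'k poly) \<Rightarrow> ((nat \<times> 'm) \<Rightarrow>\<^sub>0 'k poly)" where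
  "fscale a f = Poly_Mapping.map (\<lambda>b. a * b) f"

definition free_on :: "nat \<Rightarrow> ('k::field, 'm) skew_module \<Rightarrow> ((nat \<times> 'm) \<Rightarrow>\<^sub>0 'k poly) set" where
  "free_on k M = {f. Poly_Mapping.keys f \<subseteq> {..k} \<times> mcarrier M}"

definition prolong_relations ::
  "nat \<Rightarrow> ('k::field, 'm) skew_module \<Rightarrow> ((nat \<times> 'm) \<Rightarrow>\<^sub>0 'k poly) set" where
  "prolong_relations k M =
     {D i (madd M m1 m2) - (D i m1 + D i m2) | i m1 m2.
        i \<le> k \<and> m1 \<in> mcarrier M \<and> m2 \<in> mcarrier M} \<union>
     {D i (mscale M a m) - (\<Sum>i1\<le>i. fscale (hyperderiv i1 a) (D (i - i1) m)) | i a m.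
        i \<le> k \<and> m \<in> mcarrier M}"

definition prolong_equiv ::
  "nat \<Rightarrow> ('k::field, 'm) skew_module \<Rightarrow> ((nat \<times> 'm) \<Rightarrow>\<^sub>0 'k poly) rel" where
  "prolong_equiv k M =
     {(f, g). f \<in> free_on k M \<and> g \<in> free_on k M \<and>
        f - g \<in> module.span fscale (prolong_relations k M)}"

definition free_tau ::
  "nat \<Rightarrow> ('k::field, 'm) skew_module \<Rightarrow> ((nat \<times> 'm) \<Rightarrow>\<^sub>0 'k poly) \<Rightarrow> ((nat \<times> 'm) \<Rightarrow>\<^sub>0 'k poly)" where
  "free_tau q M f =
     (\<Sum>(i, m)\<in>Poly_Mapping.keys f.
        fscale (twist q (Poly_Mapping.lookup f (i, m))) (D i (mtau M m)))"

definition prolong ::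
  "nat \<Rightarrow> nat \<Rightarrow> ('k::field, 'm) skew_module \<Rightarrow>
   ('k, ((nat \<times> 'm) \<Rightarrow>\<^sub>0 'k poly) set) skew_module" where
  "prolong q k M =
     (let R = prolong_equiv k M in
     \<lparr>mcarrier = free_on k M // R,
      madd = (\<lambda>X Y. \<Union>f\<in>X. \<Union>g\<in>Y. R `` {f + g}),
      mscale = (\<lambda>a X. \<Union>f\<in>X. R `` {fscale a f}),
      mtau = (\<lambda>X. \<Union>f\<in>X. R `` {free_tau q M f})\<rparr>)"

text \<open>
  The prolongation of a t-module is determined up to isomorphism only, so it is a relation:
  (F, \<Psi>), of dimension n, is a k-th prolongation of (E, \<Phi>).
\<close>

definition is_prolongation ::
  "('q::{finite,field} poly fract \<Rightarrow> 'k::field) \<Rightarrow> nat \<Rightarrow>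
   ('q, 'k, 'e) alg_group \<Rightarrow> ('q poly \<Rightarrow> 'e \<Rightarrow> 'e) \<Rightarrow>
   nat \<Rightarrow> ('q, 'k, 'f) alg_group \<Rightarrow> ('q poly \<Rightarrow> 'f \<Rightarrow> 'f) \<Rightarrow> bool" where
  "is_prolongation j k E \<Phi> n F \<Psi> \<longleftrightarrow>
     t_module j n F \<Psi> \<and>
     (\<exists>h. skew_module_iso (motive j F \<Psi>) (prolong CARD('q) k (motive j E \<Phi>)) h)"


section \<open>Block matrices\<close>

definition block_mat :: "nat \<Rightarrow> nat \<Rightarrow> (nat \<Rightarrow> nat \<Rightarrow> 'k mat) \<Rightarrow> 'k mat" where
  "block_mat n d B =
     mat (n * d) (n * d) (\<lambda>(r, c). B (r div d) (c div d) $$ (r mod d, c mod d))"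

definition prolong_coeff :: "nat \<Rightarrow> nat \<Rightarrow> (nat \<Rightarrow> 'k::field mat) \<Rightarrow> nat \<Rightarrow> 'k mat" where
  "prolong_coeff k d A i =
     (if i = 0
      then block_mat (k + 1) d
        (\<lambda>I J. if I = J then A 0 else if I = J + 1 then - 1\<^sub>m d else 0\<^sub>m d d)
      else diag_block_mat (replicate (k + 1) (A i)))"

end

theory Submission
  imports Defs "Jordan_Normal_Form.Determinant"
begin

text \<open>
  Let \<open>M\<close> be the motive of the t-module \<open>E\<close>. The argument has two halves.

  Isomorphic motives come from isomorphic t-modules. The elements of a motive are the
  \<open>F\<^sub>q\<close>-linear regular functions on the group. Over an infinite field a polynomial that is additive
  and \<open>F\<^sub>q\<close>-linear has only exponents that are powers of \<open>q\<close> (\<open>additive_poly_q_exponents\<close>), so the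
  motive is generated over \<open>K{\<tau>}\<close> by the coordinate functions (\<open>hom_Ga_induct\<close>). An isomorphism of
  motives is therefore composition with the map of groups whose coordinates are the images of the
  coordinate functions, and composing with the inverse shows that this map is an isomorphism; it
  commutes with \<open>t\<close> because the isomorphism of motives does (\<open>motive_iso_realized\<close>). Comparing linear
  parts shows that the dimensions agree. Hence it is enough to find one group with an operator \<open>t\<close>
  whose motive is the prolongation of \<open>M\<close> and in which \<open>t\<close> has the required matrix.

  Such a group can be written down. Cut a vector \<open>x\<close> of length \<open>d (k + 1)\<close> into blocks
  \<open>x\<^sub>0, \<dots>, x\<^sub>k\<close>, read each block as a point of \<open>E\<close>, and let the symbol \<open>D\<^sub>i m\<close> stand for the
  function \<open>x \<mapsto> m(x\<^sub>i)\<close>. The relation \<open>D\<^sub>i(t m) = t D\<^sub>i m + D\<^sub>i\<^sub>-\<^sub>1 m\<close> says that \<open>m\<close> applied to block \<open>i\<close>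
  of \<open>t x\<close> has to be \<open>m(t x\<^sub>i) - m(x\<^sub>i\<^sub>-\<^sub>1)\<close>; since \<open>m\<close> is additive, this holds when block \<open>i\<close> of \<open>t x\<close> is
  \<open>t x\<^sub>i - x\<^sub>i\<^sub>-\<^sub>1\<close>. This is the operator \<open>T\<close> below, and its matrix is visibly the block matrix of the
  theorem (\<open>T_eq_skew_mat_apply\<close>). The general Leibniz relations follow by induction on the
  polynomial (\<open>leibniz\<close>), so the symbols can be realized as functions. Every additive function of
  \<open>x\<close> is the sum of its restrictions to the blocks, so all of them are reached. Modulo the
  relations every element is a sum of symbols \<open>D\<^sub>i m\<^sub>i\<close>, one for each \<open>i\<close>, and the \<open>m\<^sub>i\<close> can be read off at the
  vectors supported in a single block, so nothing but the relations is killed (\<open>realize_kernel\<close>).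
  Together this is \<open>motive_iso_prolong\<close>.

  Existence of a prolongation also requires that the constant term of the block matrix minus
  \<open>\<theta>\<close> is nilpotent. It is block lower triangular with nilpotent diagonal blocks
  (\<open>nilpotent_prolong_block\<close>).
\<close>

section \<open>Additive polynomials over a field containing a finite field\<close>

lemma fq_power_card: "(c::'q::{finite,field}) ^ CARD('q) = c"
proof (cases "c = 0")
  case False
  define m where "m = card (UNIV - {0::'q})"
  have "(\<Prod>x\<in>UNIV-{0}. c * x) = \<Prod>(UNIV-{0})"
    by (rule prod.reindex_bij_witness[of _ "\<lambda>x. x / c" "\<lambda>x. c * x"]) (use False in auto)
  hence "c ^ m * \<Prod>(UNIV-{0::'q}) = \<Prod>(UNIV-{0})"
    by (simp only: prod.distrib prod_constant m_def)
  moreover have "\<Prod>(UNIV-{0::'q}) \<noteq> 0" by auto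
  ultimately have "c ^ m = 1" by simp
  hence "c ^ Suc m = c" by simp
  also have "Suc m = CARD('q)"
    unfolding m_def by (rule card.remove[symmetric]) auto
  finally show ?thesis .
qed (simp add: finite_UNIV_card_ge_0)

lemma finite_field_card_gt_1: "CARD('q::{finite,field}) > 1"
  using card_mono[of "UNIV::'q set" "{0,1}"] by simp

text \<open>
  The polynomial \<open>(X + 1)^q - X^q - 1\<close> has degree below \<open>q\<close> and vanishes at all \<open>q\<close> elements of the
  field, where \<open>x^q = x\<close>. So its coefficients are zero.
\<close>

lemma binomial_fq_vanish:
  assumes "0 < i" "i < CARD('q)"
  shows "of_nat (CARD('q) choose i) = (0::'q::{finite,field})"
proof -
  define q where "q = CARD('q)"
  define p :: "'q poly" where "p = (\<Sum>i\<in>{0<..<q}. monom (of_nat (q choose i)) i)"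
  have "poly p x = 0" for x
  proof -
    have "{..q} = insert 0 (insert q {0<..<q})"
      using assms q_def by auto
    hence "(x + 1) ^ q = 1 + (x ^ q + poly p x)"
      using assms by (simp add: binomial_ring p_def poly_sum poly_monom q_def)
    thus ?thesis
      unfolding q_def fq_power_card by simp
  qed
  moreover have "degree p < q"
    unfolding p_def using assms
    by (intro degree_sum_less) (auto intro!: le_less_trans[OF degree_monom_le] simp: q_def)
  ultimately have "p = 0"
    using card_poly_roots_bound[of p] by (auto simp: q_def not_less)
  moreover have "coeff p i = of_nat (q choose i)"
    using assms unfolding p_def q_def by (simp add: coeff_sum)
  ultimately show ?thesis by (simp add: q_def)
qed

text \<open>
  Write \<open>n = q b + r\<close> with \<open>r < q\<close>, so that \<open>(1 + X)^n = (1 + X^q)^b (1 + X)^r\<close>. If \<open>b\<close> and \<open>r\<close> are both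
  positive, the coefficient of \<open>X^r\<close> is 1, against the hypothesis. If \<open>b = 0\<close>, then \<open>X^n - X\<close> has \<open>q\<close>
  roots but degree below \<open>q\<close>, so \<open>n = 1\<close>. If \<open>r = 0\<close>, then \<open>b\<close> satisfies the same hypotheses and the
  claim follows by induction.
\<close>

lemma q_power_if_binomials_vanish:
  assumes "n > 0" "\<And>i. 0 < i \<Longrightarrow> i < n \<Longrightarrow> of_nat (n choose i) = (0::'q::{finite,field})"
    and "\<And>c::'q. c ^ n = c"
  shows "\<exists>e. n = CARD('q) ^ e"
  using assms
proof (induction n rule: less_induct)
  case (less n)
  define q where "q = CARD('q)"
  have q1: "q > 1" unfolding q_def by (rule finite_field_card_gt_1)
  define b r where "b = n div q" and "r = n mod q"
  have n: "n = q * b + r" and rq: "r < q"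
    using q1 by (auto simp: b_def r_def)
  define X :: "'q poly" where "X = [:0, 1:]"
  have c1: "coeff ((1 + X) ^ m) i = of_nat (m choose i)" for m i
  proof (cases "i \<le> m")
    case True
    thus ?thesis using coeff_linear_poly_power[of i m 1 1] by (simp add: X_def one_pCons)
  next
    case False
    have "degree ((1 + X) ^ m) \<le> m"
      using degree_power_le[of "1 + X" m] by (simp add: X_def one_pCons)
    thus ?thesis using False by (simp add: coeff_eq_0 binomial_eq_0)
  qed
  have frob: "(1 + X) ^ q = 1 + monom 1 q"
  proof (rule poly_eqI)
    fix i show "coeff ((1 + X) ^ q) i = coeff (1 + monom 1 q) i"
      using q1 binomial_fq_vanish[where 'q='q, of i]
      by (cases "i = 0"; cases "i < q"; cases "i = q") (auto simp: c1 q_def[symmetric] binomial_eq_0)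
  qed
  have exp: "(1 + X) ^ n = (\<Sum>i\<le>b. monom (of_nat (b choose i)) (q * i)) * (1 + X) ^ r"
  proof -
    have "(1 + X) ^ n = (1 + monom 1 q) ^ b * (1 + X) ^ r"
      by (simp add: n power_add power_mult frob)
    also have "(1 + monom 1 q :: 'q poly) ^ b = (\<Sum>i\<le>b. monom (of_nat (b choose i)) (q * i))"
      by (subst add.commute, subst binomial_ring) 
         (simp add: monom_power of_nat_poly mult.commute smult_monom)
    finally show ?thesis .
  qed
  show ?case
  proof (cases "r = 0")
    case True
    have coeff: "of_nat (b choose i) = (of_nat (n choose (q * i)) :: 'q)" if "i \<le> b" for i
    proof -
      have "of_nat (n choose (q * i)) = coeff ((1 + X) ^ n) (q * i)" by (simp add: c1)
      also have "\<dots> = of_nat (b choose i)"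
        using that q1 by (simp add: exp True coeff_sum)
      finally show ?thesis by simp
    qed
    have "b < n" "b > 0" using True n q1 less.prems(1) by auto
    moreover have "of_nat (b choose i) = (0::'q)" if "0 < i" "i < b" for i
      using coeff[of i] less.prems(2)[of "q * i"] that q1 by (simp add: n True)
    moreover have "c ^ b = c" for c :: 'q
      using less.prems(3)[of c] by (simp add: n True power_mult q_def fq_power_card)
    ultimately obtain e where "b = CARD('q) ^ e" using less.IH by blast
    hence "n = CARD('q) ^ Suc e" by (simp add: n True q_def)
    thus ?thesis by blast
  next
    case r: False
    show ?thesis
    proof (cases "b = 0")
      case True
      hence nq: "n < q" using n rq by simp
      define f :: "'q poly" where "f = monom 1 n - monom 1 1"
      have "poly f c = 0" for c using less.prems(3)[of c] by (simp add: f_def poly_monom)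
      moreover have "degree f < q"
        unfolding f_def using nq q1
        by (intro degree_diff_less) (auto intro: le_less_trans[OF degree_monom_le])
      ultimately have "f = 0"
        using card_poly_roots_bound[of f] by (auto simp: q_def not_less)
      hence "coeff f n = 0" by simp
      hence "n = 1" by (simp add: f_def split: if_splits)
      thus ?thesis by (intro exI[of _ 0]) simp
    next
      case False
      have "of_nat (n choose r) = coeff ((1 + X) ^ n) r" by (simp add: c1)
      also have "\<dots> = (\<Sum>i\<le>b. coeff (monom (of_nat (b choose i)) (q * i) * (1 + X) ^ r) r)"
        by (simp add: exp coeff_sum sum_distrib_right)
      also have "\<dots> = (\<Sum>i\<le>b. if i = 0 then 1 else 0)"
      proof (rule sum.cong)
        fix i assume "i \<in> {..b}"
        have "r < q * i" if "i > 0" 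
          using rq that by (metis less_le_trans mult.commute mult_le_mono1 mult_1 Suc_leI One_nat_def)
        thus "coeff (monom (of_nat (b choose i)) (q * i) * (1 + X) ^ r) r = (if i = 0 then 1 else 0)"
          by (auto simp: coeff_monom_mult c1)
      qed simp
      finally have "of_nat (n choose r) = (1::'q)" by simp
      moreover have "r < n" using False n q1 by simp
      ultimately have False using less.prems(2)[of r] r by simp
      thus ?thesis ..
    qed
  qed
qed

text \<open>The field \<open>K\<close>, seen as an extension of the finite field through \<open>fq_emb j\<close>.\<close>

locale base_field =
  fixes j :: "'q::{finite,field} poly fract \<Rightarrow> 'k::field"
  assumes hom: "field_hom j"
begin

lemma fq_emb_0 [simp]: "fq_emb j 0 = 0"
  and fq_emb_1 [simp]: "fq_emb j 1 = 1"
  and fq_emb_add: "fq_emb j (a + b) = fq_emb j a + fq_emb j b"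
  and fq_emb_mult: "fq_emb j (a * b) = fq_emb j a * fq_emb j b"
proof -
  interpret field_hom j by (rule hom)
  show "fq_emb j 0 = 0" "fq_emb j 1 = 1"
    by (simp_all add: fq_emb_def flip: Zero_fract_def One_fract_def one_pCons)
  show "fq_emb j (a + b) = fq_emb j a + fq_emb j b"
    by (simp add: fq_emb_def flip: hom_add)
  show "fq_emb j (a * b) = fq_emb j a * fq_emb j b"
    by (simp add: fq_emb_def mult.commute flip: hom_mult)
qed

lemma fq_emb_power: "fq_emb j (a ^ n) = fq_emb j a ^ n"
  by (induction n) (simp_all add: fq_emb_mult)

lemma fq_emb_of_nat: "fq_emb j (of_nat n) = of_nat n"
  by (induction n) (simp_all add: fq_emb_add)

lemma fq_emb_eq_iff: "fq_emb j a = fq_emb j b \<longleftrightarrow> a = b"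
proof -
  interpret field_hom j by (rule hom)
  show ?thesis by (simp add: fq_emb_def eq_fract)
qed

lemma fq_emb_power_q: "fq_emb j a ^ CARD('q) = fq_emb j a"
  by (simp add: fq_power_card flip: fq_emb_power)

lemma frobenius_add: "(x + y :: 'k) ^ CARD('q) = x ^ CARD('q) + y ^ CARD('q)"
proof -
  have v: "of_nat (CARD('q) choose i) = (0::'k)" if "0 < i" "i < CARD('q)" for i
    using binomial_fq_vanish[OF that] fq_emb_of_nat[of "CARD('q) choose i"] by simp
  have "{..CARD('q)} = insert 0 (insert CARD('q) {0<..<CARD('q)})"
    by auto
  hence "(x + y) ^ CARD('q) = y ^ CARD('q) + (x ^ CARD('q) + (\<Sum>i\<in>{0<..<CARD('q)}. of_nat (CARD('q) choose i) * x ^ i * y ^ (CARD('q) - i)))"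
    by (simp add: binomial_ring)
  also have "(\<Sum>i\<in>{0<..<CARD('q)}. of_nat (CARD('q) choose i) * x ^ i * y ^ (CARD('q) - i)) = 0"
    by (intro sum.neutral) (auto simp: v)
  finally show ?thesis by simp
qed

lemma frobenius_sum: "(\<Sum>i\<in>I. f i :: 'k) ^ CARD('q) = (\<Sum>i\<in>I. f i ^ CARD('q))"
  by (induction I rule: infinite_finite_induct) (auto simp: frobenius_add)

lemma infinite_UNIV_K: "infinite (UNIV :: 'k set)"
proof
  assume fin: "finite (UNIV :: 'k set)"
  interpret field_hom j by (rule hom)
  define g where "g = (\<lambda>n. j (Fraction_Field.Fract (monom (1::'q) n) 1))"
  have "inj g"
    by (intro injI) (auto simp: g_def eq_fract monom_eq_iff')
  hence "infinite (range g)" using infinite_UNIV_nat finite_imageD by metis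
  thus False using finite_subset[OF subset_UNIV fin] by simp
qed

lemma poly_eqI_K:
  fixes p p' :: "'k poly"
  assumes "\<And>x. poly p x = poly p' x"
  shows "p = p'"
proof (rule ccontr)
  assume "p \<noteq> p'"
  hence "finite {x. poly (p - p') x = 0}" by (intro poly_roots_finite) simp
  thus False using infinite_UNIV_K by (simp add: assms)
qed

text \<open>
  Since \<open>K\<close> is infinite, both functional equations are identities of polynomials. The coefficients
  of \<open>x^i y^(n-i)\<close> in the first give \<open>c\<^sub>n (n choose i) = 0\<close> for \<open>0 < i < n\<close>, and the coefficients of \<open>x^n\<close>
  in the second give \<open>c\<^sub>n (c^n - c) = 0\<close> for \<open>c\<close> in the finite field.
\<close>

lemma additive_poly_q_exponents:
  fixes p :: "'k poly"
  assumes add: "\<And>x y. poly p (x + y) = poly p x + poly p y"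
    and lin: "\<And>c x. poly p (fq_emb j c * x) = fq_emb j c * poly p x"
    and nz: "coeff p n \<noteq> 0"
  shows "\<exists>e. n = CARD('q) ^ e"
proof (rule q_power_if_binomials_vanish)
  have "poly p 0 = 0" using add[of 0 0] by (metis add_0 add_right_cancel)
  thus n0: "n > 0" using nz by (cases n) (auto simp: poly_0_coeff_0)
  show "c ^ n = c" for c :: 'q
  proof -
    have "pcompose p [:0, fq_emb j c:] = smult (fq_emb j c) p"
      by (rule poly_eqI_K) (simp add: poly_pcompose lin[symmetric] mult.commute)
    from arg_cong[OF this, of "\<lambda>p. coeff p n"]
    have "fq_emb j c ^ n * coeff p n = fq_emb j c * coeff p n"
      by (simp add: coeff_pcompose_linear)
    hence "fq_emb j (c ^ n) = fq_emb j c" using nz by (simp add: fq_emb_power)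
    thus ?thesis by (simp add: fq_emb_eq_iff)
  qed
  show "of_nat (n choose i) = (0::'q)" if i: "0 < i" "i < n" for i
  proof -
    define N where "N = degree p"
    \<comment> \<open>\<open>Q i\<close>, as a polynomial in \<open>y\<close>, is the coefficient of \<open>x^i\<close> in \<open>p (x + y)\<close>.\<close>
    define Q where "Q = (\<lambda>i. \<Sum>m\<le>N. monom (coeff p m * of_nat (m choose i)) (m - i))"
    have exp: "poly p (x + y) = (\<Sum>i\<le>N. poly (Q i) y * x ^ i)" for x y
    proof -
      have "poly p (x + y) = (\<Sum>m\<le>N. coeff p m * (\<Sum>i\<le>N. of_nat (m choose i) * x ^ i * y ^ (m - i)))"
        unfolding poly_altdef N_def[symmetric]
      proof (rule sum.cong)
        fix m assume "m \<in> {..N}"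
        hence "(x + y) ^ m = (\<Sum>i\<le>N. of_nat (m choose i) * x ^ i * y ^ (m - i))"
          unfolding binomial_ring by (intro sum.mono_neutral_left) (auto simp: binomial_eq_0)
        thus "coeff p m * (x + y) ^ m = coeff p m * (\<Sum>i\<le>N. of_nat (m choose i) * x ^ i * y ^ (m - i))"
          by simp
      qed simp
      also have "\<dots> = (\<Sum>i\<le>N. \<Sum>m\<le>N. coeff p m * (of_nat (m choose i) * x ^ i * y ^ (m - i)))"
        unfolding sum_distrib_left by (rule sum.swap)
      also have "\<dots> = (\<Sum>i\<le>N. poly (Q i) y * x ^ i)"
        by (simp add: Q_def poly_sum poly_monom sum_distrib_left mult_ac)
      finally show ?thesis .
    qed
    have iN: "i \<le> N" "n \<le> N" using i nz by (auto simp: N_def dest: le_degree)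
    have "poly (Q i) y = coeff p i" for y
    proof -
      have "(\<Sum>i\<le>N. monom (poly (Q i) y) i) = p + [:poly p y:]"
        by (rule poly_eqI_K) (simp add: poly_sum poly_monom add exp[symmetric])
      from arg_cong[OF this, of "\<lambda>p. coeff p i"] show ?thesis
        using i iN by (simp add: coeff_sum coeff_pCons split: nat.splits)
    qed
    hence "Q i = [:coeff p i:]" by (intro poly_eqI_K) simp
    from arg_cong[OF this, of "\<lambda>p. coeff p (n - i)"]
    have "(\<Sum>m\<le>N. if m - i = n - i then coeff p m * of_nat (m choose i) else 0) = 0"
      using i by (simp add: Q_def coeff_sum coeff_pCons split: nat.splits)
    also have "(\<Sum>m\<le>N. if m - i = n - i then coeff p m * of_nat (m choose i) else 0)
        = (\<Sum>m\<le>N. if m = n then coeff p m * of_nat (m choose i) else 0)"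
      using i by (intro sum.cong) auto
    also have "\<dots> = coeff p n * of_nat (n choose i)" using iN by simp
    finally have "fq_emb j (of_nat (n choose i)) = fq_emb j 0"
      using nz by (simp add: fq_emb_of_nat)
    thus ?thesis by (simp only: fq_emb_eq_iff)
  qed
qed

end

section \<open>Groups isomorphic to a power of the additive group\<close>

lemma additive_vec_decomp:
  fixes g :: "'k::field vec \<Rightarrow> 'k"
  assumes add: "\<And>v w. v \<in> carrier_vec d \<Longrightarrow> w \<in> carrier_vec d \<Longrightarrow> g (v + w) = g v + g w"
    and x: "x \<in> carrier_vec d"
  shows "g x = (\<Sum>r<d. g (x $ r \<cdot>\<^sub>v unit_vec d r))"
proof -
  define tr where "tr m = vec d (\<lambda>i. if i < m then x $ i else 0)" for m
  have g0: "g (0\<^sub>v d) = 0"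
    using add[of "0\<^sub>v d" "0\<^sub>v d"] by (metis add_0 add_right_cancel left_zero_vec zero_carrier_vec)
  have "g (tr m) = (\<Sum>r<m. g (x $ r \<cdot>\<^sub>v unit_vec d r))" if "m \<le> d" for m
    using that
  proof (induction m)
    case 0
    have "tr 0 = 0\<^sub>v d" by (auto simp: tr_def)
    thus ?case by (simp add: g0)
  next
    case (Suc m)
    have "tr (Suc m) = tr m + x $ m \<cdot>\<^sub>v unit_vec d m"
      using Suc.prems by (intro eq_vecI) (auto simp: tr_def less_Suc_eq)
    thus ?case using Suc by (simp add: add tr_def)
  qed
  moreover have "tr d = x" using x by (intro eq_vecI) (auto simp: tr_def)
  ultimately show ?thesis by (metis order_refl)
qed

lemma poly_funs_axis:
  assumes "P \<in> poly_funs d" "r < d"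
  shows "\<exists>p. \<forall>u. P (u \<cdot>\<^sub>v unit_vec d r) = poly p u"
  using assms(1)
proof induction
  case (const c)
  show ?case by (intro exI[of _ "[:c:]"]) simp
next
  case (coord i)
  show ?case
    by (intro exI[of _ "if i = r then [:0, 1:] else 0"]) (use coord assms(2) in auto)
next
  case (add f g)
  thus ?case by (metis poly_add)
next
  case (mult f g)
  thus ?case by (metis poly_mult)
qed

lemma poly_funs_scale: "P \<in> poly_funs d \<Longrightarrow> (\<lambda>x. c * P x) \<in> poly_funs d"
  by (rule poly_funs.mult[OF poly_funs.const])

lemma poly_funs_power: "P \<in> poly_funs d \<Longrightarrow> (\<lambda>x. P x ^ n) \<in> poly_funs d"
  by (induction n) (auto intro: poly_funs.const poly_funs.mult)

lemma poly_funs_compose: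
  assumes "P \<in> poly_funs n" "\<And>r. r < n \<Longrightarrow> Q r \<in> poly_funs d"
  shows "(\<lambda>x. P (vec n (\<lambda>r. Q r x))) \<in> poly_funs d"
  using assms(1) by induction (auto intro: poly_funs.intros assms(2))

text \<open>
  A group together with an isomorphism \<open>\<kappa>\<close> to a power of the additive group. The second condition
  makes a regular function determined by its values on the points of the group.
\<close>

locale vector_group = base_field j
  for j :: "'q::{finite,field} poly fract \<Rightarrow> 'k::field" +
  fixes d :: nat and E :: "('q, 'k, 'e) alg_group" and \<kappa> :: "'e \<Rightarrow> 'k vec"
  assumes iso: "alg_iso E (Ga j d) \<kappa>"
    and ext: "regular E \<subseteq> extensional (points E)"
begin

definition unchart :: "'k vec \<Rightarrow> 'e" where "unchart = inv_into (points E) \<kappa>"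

lemma chart_in [simp]: "x \<in> points E \<Longrightarrow> \<kappa> x \<in> carrier_vec d"
  using iso by (auto simp: alg_iso_def alg_hom_def Ga_def)

lemma dim_chart [simp]: "x \<in> points E \<Longrightarrow> dim_vec (\<kappa> x) = d"
  using chart_in by fastforce

lemma unchart_in [simp]: "v \<in> carrier_vec d \<Longrightarrow> unchart v \<in> points E"
  using iso by (auto simp: alg_iso_def alg_hom_def Ga_def unchart_def)

lemma chart_unchart [simp]: "v \<in> carrier_vec d \<Longrightarrow> \<kappa> (unchart v) = v"
  using iso unfolding alg_iso_def Ga_def unchart_def by (auto intro: bij_betw_inv_into_right)

lemma unchart_chart [simp]: "x \<in> points E \<Longrightarrow> unchart (\<kappa> x) = x"
  using iso unfolding alg_iso_def Ga_def unchart_def by (auto intro: bij_betw_inv_into_left)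

lemma chart_inj: "x \<in> points E \<Longrightarrow> y \<in> points E \<Longrightarrow> \<kappa> x = \<kappa> y \<Longrightarrow> x = y"
  using unchart_chart by metis

lemma chart_add [simp]:
  "x \<in> points E \<Longrightarrow> y \<in> points E \<Longrightarrow> \<kappa> (gadd E x y) = \<kappa> x + \<kappa> y"
  using iso by (auto simp: alg_iso_def alg_hom_def Ga_def)

lemma chart_act [simp]: "x \<in> points E \<Longrightarrow> \<kappa> (fq_act E c x) = fq_emb j c \<cdot>\<^sub>v \<kappa> x"
  using iso by (auto simp: alg_iso_def alg_hom_def Ga_def)

lemma unchart_add:
  "v \<in> carrier_vec d \<Longrightarrow> w \<in> carrier_vec d \<Longrightarrow> unchart (v + w) = gadd E (unchart v) (unchart w)"
  using iso by (auto simp: alg_iso_def alg_hom_def Ga_def unchart_def)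

lemma unchart_act: "v \<in> carrier_vec d \<Longrightarrow> unchart (fq_emb j c \<cdot>\<^sub>v v) = fq_act E c (unchart v)"
  using iso by (auto simp: alg_iso_def alg_hom_def Ga_def unchart_def)

lemma gadd_in [simp]: "x \<in> points E \<Longrightarrow> y \<in> points E \<Longrightarrow> gadd E x y \<in> points E"
  using unchart_add[of "\<kappa> x" "\<kappa> y"] unchart_in[of "\<kappa> x + \<kappa> y"] by simp

lemma fq_act_in [simp]: "x \<in> points E \<Longrightarrow> fq_act E c x \<in> points E"
  using unchart_act[of "\<kappa> x" c] unchart_in[of "fq_emb j c \<cdot>\<^sub>v \<kappa> x"] by simp

lemma regularI:
  assumes P: "P \<in> poly_funs d" and f: "\<And>x. x \<in> points E \<Longrightarrow> f x = P (\<kappa> x)"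
  shows "restrict f (points E) \<in> regular E"
proof -
  have "restrict P (carrier_vec d) \<in> regular (Ga j d)"
    using P by (simp add: Ga_def)
  hence "restrict (restrict P (carrier_vec d) \<circ> \<kappa>) (points E) \<in> regular E"
    using iso by (auto simp: alg_iso_def alg_hom_def)
  also have "restrict (restrict P (carrier_vec d) \<circ> \<kappa>) (points E) = restrict f (points E)"
    using f by (intro restrict_ext) simp
  finally show ?thesis .
qed

lemma regularD:
  assumes "f \<in> regular E"
  obtains P where "P \<in> poly_funs d" "\<And>x. x \<in> points E \<Longrightarrow> f x = P (\<kappa> x)"
proof -
  have "restrict (f \<circ> unchart) (carrier_vec d) \<in> regular (Ga j d)"
    using iso assms by (auto simp: alg_iso_def alg_hom_def unchart_def Ga_def)
  then obtain P where P: "P \<in> poly_funs d"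
    "restrict (f \<circ> unchart) (carrier_vec d) = restrict P (carrier_vec d)"
    by (auto simp: Ga_def)
  have "f x = P (\<kappa> x)" if "x \<in> points E" for x
    using fun_cong[OF P(2), of "\<kappa> x"] that by simp
  with P(1) show ?thesis using that by blast
qed

lemma hom_GaI:
  assumes "\<exists>P\<in>poly_funs d. \<forall>x\<in>points E. f x = P (\<kappa> x)"
    and "\<And>x y. x \<in> points E \<Longrightarrow> y \<in> points E \<Longrightarrow> f (gadd E x y) = f x + f y"
    and "\<And>c x. x \<in> points E \<Longrightarrow> f (fq_act E c x) = fq_emb j c * f x"
  shows "restrict f (points E) \<in> hom_Ga j E"
  using assms by (auto simp: hom_Ga_def intro: regularI)

lemma hom_Ga_regular:
  assumes "f \<in> hom_Ga j E"
  obtains P where "P \<in> poly_funs d" "\<And>x. x \<in> points E \<Longrightarrow> f x = P (\<kappa> x)"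
  using assms regularD by (auto simp: hom_Ga_def)

lemma hom_Ga_add:
  "f \<in> hom_Ga j E \<Longrightarrow> x \<in> points E \<Longrightarrow> y \<in> points E \<Longrightarrow> f (gadd E x y) = f x + f y"
  by (simp add: hom_Ga_def)

lemma hom_Ga_act: "f \<in> hom_Ga j E \<Longrightarrow> x \<in> points E \<Longrightarrow> f (fq_act E c x) = fq_emb j c * f x"
  by (simp add: hom_Ga_def)

lemma hom_Ga_ext: "f \<in> hom_Ga j E \<Longrightarrow> f \<in> extensional (points E)"
  using ext by (auto simp: hom_Ga_def)

lemma hom_Ga_eqI:
  "f \<in> hom_Ga j E \<Longrightarrow> g \<in> hom_Ga j E \<Longrightarrow> (\<And>x. x \<in> points E \<Longrightarrow> f x = g x) \<Longrightarrow> f = g"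
  using hom_Ga_ext by (blast intro: extensionalityI)

lemma hom_Ga_restrict: "f \<in> hom_Ga j E \<Longrightarrow> restrict f (points E) = f"
  using hom_Ga_ext by (simp add: extensional_restrict)

lemma zero_in_hom_Ga: "restrict (\<lambda>_. 0) (points E) \<in> hom_Ga j E"
  by (rule hom_GaI) (auto intro: bexI[OF _ poly_funs.const[of 0]])

lemma coord_in_hom_Ga: "r < d \<Longrightarrow> restrict (\<lambda>x. \<kappa> x $ r) (points E) \<in> hom_Ga j E"
  by (rule hom_GaI) (auto intro: bexI[OF _ poly_funs.coord[of r]])

lemma add_in_hom_Ga:
  assumes "f \<in> hom_Ga j E" "g \<in> hom_Ga j E"
  shows "restrict (\<lambda>x. f x + g x) (points E) \<in> hom_Ga j E"
proof -
  obtain P Q where "P \<in> poly_funs d" "\<And>x. x \<in> points E \<Longrightarrow> f x = P (\<kappa> x)"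
    "Q \<in> poly_funs d" "\<And>x. x \<in> points E \<Longrightarrow> g x = Q (\<kappa> x)"
    using assms hom_Ga_regular by metis
  hence "\<exists>R\<in>poly_funs d. \<forall>x\<in>points E. f x + g x = R (\<kappa> x)"
    by (intro bexI[of _ "\<lambda>v. P v + Q v"] poly_funs.add) auto
  thus ?thesis
    by (rule hom_GaI)
       (auto simp: hom_Ga_add[OF assms(1)] hom_Ga_add[OF assms(2)]
          hom_Ga_act[OF assms(1)] hom_Ga_act[OF assms(2)] algebra_simps)
qed

lemma scale_in_hom_Ga:
  assumes "f \<in> hom_Ga j E"
  shows "restrict (\<lambda>x. c * f x) (points E) \<in> hom_Ga j E"
proof -
  obtain P where "P \<in> poly_funs d" "\<And>x. x \<in> points E \<Longrightarrow> f x = P (\<kappa> x)"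
    using assms hom_Ga_regular by metis
  hence "\<exists>R\<in>poly_funs d. \<forall>x\<in>points E. c * f x = R (\<kappa> x)"
    by (intro bexI[of _ "\<lambda>v. c * P v"] poly_funs_scale) auto
  thus ?thesis
    by (rule hom_GaI)
       (auto simp: hom_Ga_add[OF assms(1)] hom_Ga_act[OF assms(1)] algebra_simps)
qed

lemma frobenius_in_hom_Ga:
  assumes "f \<in> hom_Ga j E"
  shows "restrict (\<lambda>x. f x ^ CARD('q)) (points E) \<in> hom_Ga j E"
proof -
  obtain P where "P \<in> poly_funs d" "\<And>x. x \<in> points E \<Longrightarrow> f x = P (\<kappa> x)"
    using assms hom_Ga_regular by metis
  hence "\<exists>R\<in>poly_funs d. \<forall>x\<in>points E. f x ^ CARD('q) = R (\<kappa> x)"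
    by (intro bexI[of _ "\<lambda>v. P v ^ CARD('q)"] poly_funs_power) auto
  thus ?thesis
    by (rule hom_GaI)
       (auto simp: hom_Ga_add[OF assms(1)] hom_Ga_act[OF assms(1)] frobenius_add
          power_mult_distrib fq_emb_power_q)
qed

lemma sum_in_hom_Ga:
  assumes "\<And>i. i \<in> I \<Longrightarrow> restrict (f i) (points E) \<in> hom_Ga j E"
  shows "restrict (\<lambda>x. \<Sum>i\<in>I. f i x) (points E) \<in> hom_Ga j E"
  using assms
proof (induction I rule: infinite_finite_induct)
  case (insert i I)
  have "restrict (\<lambda>x. restrict (f i) (points E) x + restrict (\<lambda>x. \<Sum>i\<in>I. f i x) (points E) x) (points E)
      \<in> hom_Ga j E"
    using insert by (intro add_in_hom_Ga) auto
  also have "restrict (\<lambda>x. restrict (f i) (points E) x + restrict (\<lambda>x. \<Sum>i\<in>I. f i x) (points E) x) (points E)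
      = restrict (\<lambda>x. \<Sum>i\<in>insert i I. f i x) (points E)"
    using insert by (intro restrict_ext) simp
  finally show ?case .
qed (auto simp: zero_in_hom_Ga)

lemma compose_in_hom_Ga:
  assumes "alg_hom E F \<phi>" "f \<in> hom_Ga j F"
  shows "restrict (f \<circ> \<phi>) (points E) \<in> hom_Ga j E"
  using assms unfolding alg_hom_def hom_Ga_def by (auto simp: Pi_iff)

text \<open>
  An additive function is the sum of its restrictions to the coordinate axes, and each of these is
  an additive polynomial in one variable.
\<close>

lemma hom_Ga_decomp:
  assumes f: "f \<in> hom_Ga j E"
  obtains p where "\<And>r n. r < d \<Longrightarrow> coeff (p r) n \<noteq> 0 \<Longrightarrow> \<exists>e. n = CARD('q) ^ e"
    and "\<And>x. x \<in> points E \<Longrightarrow> f x = (\<Sum>r<d. poly (p r) (\<kappa> x $ r))"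
proof -
  obtain P where P: "P \<in> poly_funs d" "\<And>x. x \<in> points E \<Longrightarrow> f x = P (\<kappa> x)"
    using f hom_Ga_regular by metis
  have fP: "P v = f (unchart v)" if "v \<in> carrier_vec d" for v
    using P(2)[of "unchart v"] that by simp
  have Padd: "P (v + w) = P v + P w" if "v \<in> carrier_vec d" "w \<in> carrier_vec d" for v w
    using that by (simp add: fP unchart_add hom_Ga_add[OF f])
  have Pact: "P (fq_emb j c \<cdot>\<^sub>v v) = fq_emb j c * P v" if "v \<in> carrier_vec d" for v c
    using that by (simp add: fP unchart_act hom_Ga_act[OF f])
  obtain p where p: "\<And>r u. r < d \<Longrightarrow> P (u \<cdot>\<^sub>v unit_vec d r) = poly (p r) u"
    using poly_funs_axis[OF P(1)] by metis
  show ?thesis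
  proof
    fix r n assume r: "r < d" and n: "coeff (p r) n \<noteq> 0"
    show "\<exists>e. n = CARD('q) ^ e"
    proof (rule additive_poly_q_exponents[OF _ _ n])
      show "poly (p r) (x + y) = poly (p r) x + poly (p r) y" for x y
        using r by (simp add: p[symmetric] add_smult_distrib_vec Padd)
      show "poly (p r) (fq_emb j c * x) = fq_emb j c * poly (p r) x" for c x
        using r by (simp add: p[symmetric] Pact flip: smult_smult_assoc)
    qed
  next
    fix x assume "x \<in> points E"
    thus "f x = (\<Sum>r<d. poly (p r) (\<kappa> x $ r))"
      by (simp add: P(2) p[symmetric] additive_vec_decomp[of d P, OF Padd])
  qed
qed

text \<open>
  The motive is generated by the coordinate functions as a left module over \<open>K{\<tau>}\<close>; hence two
  semilinear maps on it that agree on coordinates are equal.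
\<close>

lemma hom_Ga_induct [consumes 1, case_names zero coord add scale frobenius]:
  assumes f: "f \<in> hom_Ga j E"
    and zero: "Q (restrict (\<lambda>_. 0) (points E))"
    and coord: "\<And>r. r < d \<Longrightarrow> Q (restrict (\<lambda>x. \<kappa> x $ r) (points E))"
    and add: "\<And>f g. f \<in> hom_Ga j E \<Longrightarrow> Q f \<Longrightarrow> g \<in> hom_Ga j E \<Longrightarrow> Q g \<Longrightarrow>
                Q (restrict (\<lambda>x. f x + g x) (points E))"
    and scale: "\<And>c f. f \<in> hom_Ga j E \<Longrightarrow> Q f \<Longrightarrow> Q (restrict (\<lambda>x. c * f x) (points E))"
    and frobenius: "\<And>f. f \<in> hom_Ga j E \<Longrightarrow> Q f \<Longrightarrow> Q (restrict (\<lambda>x. f x ^ CARD('q)) (points E))"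
  shows "Q f"
proof -
  define S where "S = {f \<in> hom_Ga j E. Q f}"
  have S_cong: "restrict g (points E) \<in> S" if "restrict h (points E) \<in> S"
    "\<And>x. x \<in> points E \<Longrightarrow> g x = h x" for g h
    using that by (metis restrict_ext)
  have S_sum: "restrict (\<lambda>x. \<Sum>i\<in>I. g i x) (points E) \<in> S"
    if "\<And>i. i \<in> I \<Longrightarrow> restrict (g i) (points E) \<in> S" for I :: "nat set" and g
    using that
  proof (induction I rule: infinite_finite_induct)
    case (insert i I)
    hence "restrict (\<lambda>x. restrict (g i) (points E) x + restrict (\<lambda>x. \<Sum>i\<in>I. g i x) (points E) x) (points E) \<in> S"
      by (auto simp: S_def intro!: add add_in_hom_Ga)
    thus ?case by (rule S_cong) (use insert in simp)
  qed (auto simp: S_def zero zero_in_hom_Ga)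
  have S_scale: "restrict (\<lambda>x. c * g x) (points E) \<in> S" if "restrict g (points E) \<in> S" for g c
  proof (rule S_cong)
    show "restrict (\<lambda>x. c * restrict g (points E) x) (points E) \<in> S"
      using that scale[of "restrict g (points E)" c] scale_in_hom_Ga[of "restrict g (points E)" c]
      unfolding S_def by blast
  qed simp
  have S_pow: "restrict (\<lambda>x. (\<kappa> x $ r) ^ (CARD('q) ^ e)) (points E) \<in> S" if "r < d" for r e
  proof (induction e)
    case 0
    show ?case
    proof (rule S_cong)
      show "restrict (\<lambda>x. \<kappa> x $ r) (points E) \<in> S"
        using coord[OF that] coord_in_hom_Ga[OF that] unfolding S_def by blast
    qed simp
  next
    case (Suc e)
    show ?case
    proof (rule S_cong)
      show "restrict (\<lambda>x. restrict (\<lambda>x. (\<kappa> x $ r) ^ (CARD('q) ^ e)) (points E) x ^ CARD('q)) (points E) \<in> S"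
        using Suc frobenius frobenius_in_hom_Ga unfolding S_def by blast
    qed (simp add: power_mult[symmetric] mult.commute)
  qed
  obtain p where p: "\<And>r n. r < d \<Longrightarrow> coeff (p r) n \<noteq> 0 \<Longrightarrow> \<exists>e. n = CARD('q) ^ e"
    and fp: "\<And>x. x \<in> points E \<Longrightarrow> f x = (\<Sum>r<d. poly (p r) (\<kappa> x $ r))"
    using hom_Ga_decomp[OF f] by metis
  have "restrict (\<lambda>x. coeff (p r) n * (\<kappa> x $ r) ^ n) (points E) \<in> S" if r: "r < d" for r n
  proof (cases "coeff (p r) n = 0")
    case True
    thus ?thesis by (simp add: S_def zero zero_in_hom_Ga)
  next
    case False
    then obtain e where n: "n = CARD('q) ^ e" using p[OF r] by blast
    show ?thesis unfolding n by (rule S_scale[OF S_pow[OF r]])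
  qed
  hence "restrict (\<lambda>x. \<Sum>r<d. poly (p r) (\<kappa> x $ r)) (points E) \<in> S"
    unfolding poly_altdef by (intro S_sum) auto
  hence "restrict f (points E) \<in> S"
    by (rule S_cong) (simp add: fp)
  thus ?thesis using f by (simp add: S_def hom_Ga_restrict)
qed

end

section \<open>The motive as a module\<close>

text \<open>
  The action of a polynomial in \<open>t\<close> on functions when \<open>t\<close> acts by composition with \<open>S\<close>. It is used
  both for motives and, before restricting to any set of points, for all functions of a vector.
\<close>

definition act :: "('e \<Rightarrow> 'e) \<Rightarrow> 'k::field poly \<Rightarrow> ('e \<Rightarrow> 'k) \<Rightarrow> 'e \<Rightarrow> 'k" where
  "act S a m x = (\<Sum>i\<le>degree a. coeff a i * m ((S ^^ i) x))"

lemma motive_simps: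
  "mcarrier (motive j E \<Phi>) = hom_Ga j E"
  "madd (motive j E \<Phi>) m n = restrict (\<lambda>x. m x + n x) (points E)"
  "mscale (motive j E \<Phi>) a m = restrict (act (\<Phi> t_var) a m) (points E)"
  "mtau (motive j E \<Phi>) m = restrict (\<lambda>x. m x ^ CARD('q)) (points E)"
  for j :: "'q::{finite,field} poly fract \<Rightarrow> 'k::field"
  by (simp_all add: motive_def act_def[abs_def])

lemma act_const [simp]: "act S [:c:] m = (\<lambda>x. c * m x)"
  by (simp add: act_def[abs_def])

lemma act_t_var [simp]: "act S [:0, 1:] m = (\<lambda>x. m (S x))"
  by (simp add: act_def[abs_def])

lemma alg_hom_id: "regular E \<subseteq> extensional (points E) \<Longrightarrow> alg_hom E E (\<lambda>x. x)"
  by (auto simp: alg_hom_def comp_def extensional_restrict subset_iff)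

lemma (in vector_group) alg_hom_compose:
  assumes "alg_hom E F \<phi>" "alg_hom F G \<psi>"
  shows "alg_hom E G (\<lambda>x. \<psi> (\<phi> x))"
proof -
  have "restrict (f \<circ> (\<lambda>x. \<psi> (\<phi> x))) (points E) \<in> regular E" if "f \<in> regular G" for f
  proof -
    have "restrict (restrict (f \<circ> \<psi>) (points F) \<circ> \<phi>) (points E) \<in> regular E"
      using assms that by (auto simp: alg_hom_def)
    also have "restrict (restrict (f \<circ> \<psi>) (points F) \<circ> \<phi>) (points E) = restrict (f \<circ> (\<lambda>x. \<psi> (\<phi> x))) (points E)"
      using assms by (intro restrict_ext) (auto simp: alg_hom_def)
    finally show ?thesis .
  qed
  thus ?thesis using assms by (auto simp: alg_hom_def Pi_iff)
qed

lemma (in vector_group) alg_hom_funpow: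
  assumes "alg_hom E E S"
  shows "alg_hom E E (S ^^ i)"
proof (induction i)
  case 0
  show ?case using alg_hom_id[OF ext] by (simp add: id_def)
next
  case (Suc i)
  show ?case using alg_hom_compose[OF Suc assms] by (simp add: comp_def)
qed

lemma (in vector_group) act_in_hom_Ga:
  assumes S: "alg_hom E E S" and m: "m \<in> hom_Ga j E"
  shows "restrict (act S a m) (points E) \<in> hom_Ga j E"
proof -
  have "restrict (\<lambda>x. coeff a i * m ((S ^^ i) x)) (points E) \<in> hom_Ga j E" for i
  proof -
    have "restrict (\<lambda>x. coeff a i * restrict (m \<circ> (S ^^ i)) (points E) x) (points E) \<in> hom_Ga j E"
      by (rule scale_in_hom_Ga[OF compose_in_hom_Ga[OF alg_hom_funpow[OF S] m]])
    also have "restrict (\<lambda>x. coeff a i * restrict (m \<circ> (S ^^ i)) (points E) x) (points E)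
        = restrict (\<lambda>x. coeff a i * m ((S ^^ i) x)) (points E)"
      by (intro restrict_ext) simp
    finally show ?thesis .
  qed
  thus ?thesis unfolding act_def by (intro sum_in_hom_Ga)
qed

text \<open>
  The operations of a skew module are total functions. The inverse of an isomorphism is compatible
  with them only when they do not leave the carrier.
\<close>

definition closed_skew_module :: "('k::zero, 'm) skew_module \<Rightarrow> bool" where
  "closed_skew_module M \<longleftrightarrow>
     (\<forall>x\<in>mcarrier M. \<forall>y\<in>mcarrier M. madd M x y \<in> mcarrier M) \<and>
     (\<forall>a. \<forall>x\<in>mcarrier M. mscale M a x \<in> mcarrier M) \<and>
     (\<forall>x\<in>mcarrier M. mtau M x \<in> mcarrier M)"

lemma (in vector_group) closed_motive:
  "alg_hom E E (\<Phi> t_var) \<Longrightarrow> closed_skew_module (motive j E \<Phi>)"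
  by (simp add: closed_skew_module_def motive_simps add_in_hom_Ga act_in_hom_Ga frobenius_in_hom_Ga)

lemma skew_module_iso_trans_inv:
  assumes M: "skew_module_iso M P h" and N: "skew_module_iso N P g"
    and cl: "closed_skew_module N"
  shows "skew_module_iso M N (\<lambda>x. inv_into (mcarrier N) g (h x))"
proof -
  define w where "w x = inv_into (mcarrier N) g (h x)" for x
  have bM: "bij_betw h (mcarrier M) (mcarrier P)" and bN: "bij_betw g (mcarrier N) (mcarrier P)"
    using M N by (auto simp: skew_module_iso_def)
  have wb: "bij_betw w (mcarrier M) (mcarrier N)"
    using bij_betw_trans[OF bM bij_betw_inv_into[OF bN]] by (simp add: comp_def w_def[abs_def])
  have w_in: "w x \<in> mcarrier N" if "x \<in> mcarrier M" for x
    using wb that by (auto simp: bij_betw_def)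
  have gw: "g (w x) = h x" if "x \<in> mcarrier M" for x
    using bij_betw_inv_into_right[OF bN, of "h x"] bM that by (auto simp: w_def bij_betw_def)
  have wI: "w x = y" if "h x = g y" "y \<in> mcarrier N" for x y
    using bij_betw_inv_into_left[OF bN, of y] that by (simp add: w_def)
  have "skew_module_iso M N w"
    unfolding skew_module_iso_def
  proof (intro conjI ballI allI)
    show "bij_betw w (mcarrier M) (mcarrier N)" by (rule wb)
  next
    fix x y assume "x \<in> mcarrier M" "y \<in> mcarrier M"
    thus "w (madd M x y) = madd N (w x) (w y)"
      using M N cl w_in gw by (intro wI) (simp_all add: skew_module_iso_def closed_skew_module_def)
  next
    fix a x assume "x \<in> mcarrier M"
    thus "w (mscale M a x) = mscale N a (w x)"
      using M N cl w_in gw by (intro wI) (simp_all add: skew_module_iso_def closed_skew_module_def)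
  next
    fix x assume "x \<in> mcarrier M"
    thus "w (mtau M x) = mtau N (w x)"
      using M N cl w_in gw by (intro wI) (simp_all add: skew_module_iso_def closed_skew_module_def)
  qed
  thus ?thesis by (simp add: w_def[abs_def])
qed

lemma skew_module_iso_refl: "skew_module_iso M M (\<lambda>x. x)"
  by (auto simp: skew_module_iso_def bij_betw_def inj_on_def)

section \<open>Morphisms of motives come from morphisms of groups\<close>

context base_field
begin

text \<open>
  A regular function on the target is a polynomial in the coordinates, so a map is a morphism as
  soon as its coordinates are additive, linear and regular.
\<close>

lemma alg_hom_by_coordinates:
  fixes E :: "('q, 'k, 'e) alg_group" and F :: "('q, 'k, 'f) alg_group"
    and \<mu> :: "'f \<Rightarrow> 'k vec"
  assumes "vector_group j d E \<kappa>" and "vector_group j n F \<mu>"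
    and pts: "\<And>x. x \<in> points E \<Longrightarrow> \<phi> x \<in> points F"
    and coords: "\<And>r. r < n \<Longrightarrow> restrict (\<lambda>x. \<mu> (\<phi> x) $ r) (points E) \<in> hom_Ga j E"
  shows "alg_hom E F \<phi>"
proof -
  interpret E: vector_group j d E \<kappa> by fact
  interpret F: vector_group j n F \<mu> by fact
  have cadd: "\<mu> (\<phi> (gadd E x y)) $ r = \<mu> (\<phi> x) $ r + \<mu> (\<phi> y) $ r"
    if "x \<in> points E" "y \<in> points E" "r < n" for x y r
    using E.hom_Ga_add[OF coords] that by simp
  have cact: "\<mu> (\<phi> (fq_act E c x)) $ r = fq_emb j c * \<mu> (\<phi> x) $ r"
    if "x \<in> points E" "r < n" for c x r
    using E.hom_Ga_act[OF coords] that by simp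
  show ?thesis
    unfolding alg_hom_def
  proof (intro conjI ballI allI)
    show "\<phi> \<in> points E \<rightarrow> points F" using pts by blast
  next
    fix x y assume xy: "x \<in> points E" "y \<in> points E"
    show "\<phi> (gadd E x y) = gadd F (\<phi> x) (\<phi> y)"
      using xy pts by (intro F.chart_inj eq_vecI) (auto simp: cadd)
  next
    fix c x assume x: "x \<in> points E"
    show "\<phi> (fq_act E c x) = fq_act F c (\<phi> x)"
      using x pts by (intro F.chart_inj eq_vecI) (auto simp: cact)
  next
    fix f assume "f \<in> regular F"
    then obtain P where P: "P \<in> poly_funs n" "\<And>y. y \<in> points F \<Longrightarrow> f y = P (\<mu> y)"
      using F.regularD by blast
    have "\<forall>r. \<exists>Q. r < n \<longrightarrow> Q \<in> poly_funs d \<and> (\<forall>x\<in>points E. \<mu> (\<phi> x) $ r = Q (\<kappa> x))"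
      using E.hom_Ga_regular[OF coords] by (metis restrict_apply)
    then obtain Q where Q: "\<And>r. r < n \<Longrightarrow> Q r \<in> poly_funs d"
      "\<And>r x. r < n \<Longrightarrow> x \<in> points E \<Longrightarrow> \<mu> (\<phi> x) $ r = Q r (\<kappa> x)"
      by metis
    have "\<mu> (\<phi> x) = vec n (\<lambda>r. Q r (\<kappa> x))" if "x \<in> points E" for x
      using that pts Q(2) by (intro eq_vecI) auto
    hence "(f \<circ> \<phi>) x = P (vec n (\<lambda>r. Q r (\<kappa> x)))" if "x \<in> points E" for x
      using that pts P(2) by simp
    thus "restrict (f \<circ> \<phi>) (points E) \<in> regular E"
      by (intro E.regularI[OF poly_funs_compose[OF P(1), of Q]]) (auto simp: Q(1))
  qed
qed

text \<open>
  The morphism of groups is forced: its coordinates have to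
  be the images of the coordinate functions. Both sides of the claim are additive and compatible
  with scalars and \<open>\<tau>\<close> as functions of \<open>f\<close>, so it suffices that they agree on coordinates.
\<close>

lemma motive_morphism_realized:
  fixes u :: "('f \<Rightarrow> 'k) \<Rightarrow> 'e \<Rightarrow> 'k" and \<mu> :: "'f \<Rightarrow> 'k vec"
  assumes "vector_group j d E \<kappa>" and "vector_group j n F \<mu>"
    and u: "skew_module_iso (motive j F \<Psi>) (motive j E \<Phi>) u"
  obtains \<phi> where "alg_hom E F \<phi>"
    "\<And>f x. f \<in> hom_Ga j F \<Longrightarrow> x \<in> points E \<Longrightarrow> u f x = f (\<phi> x)"
proof -
  interpret E: vector_group j d E \<kappa> by fact
  interpret F: vector_group j n F \<mu> by fact
  have u_in: "u f \<in> hom_Ga j E" if "f \<in> hom_Ga j F" for f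
    using u that by (auto simp: skew_module_iso_def motive_simps bij_betw_def)
  have u_add: "u (restrict (\<lambda>y. f y + g y) (points F)) x = u f x + u g x"
    if "f \<in> hom_Ga j F" "g \<in> hom_Ga j F" "x \<in> points E" for f g x
    using u that by (simp add: skew_module_iso_def motive_simps)
  have u_scale: "u (restrict (\<lambda>y. c * f y) (points F)) x = c * u f x"
    if "f \<in> hom_Ga j F" "x \<in> points E" for f c x
  proof -
    have "u (restrict (act (\<Psi> t_var) [:c:] f) (points F)) = restrict (act (\<Phi> t_var) [:c:] (u f)) (points E)"
      using u that unfolding skew_module_iso_def motive_simps by blast
    thus ?thesis using that by simp
  qed
  have u_tau: "u (restrict (\<lambda>y. f y ^ CARD('q)) (points F)) x = u f x ^ CARD('q)"
    if "f \<in> hom_Ga j F" "x \<in> points E" for f x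
    using u that by (simp add: skew_module_iso_def motive_simps)
  define y where "y r = restrict (\<lambda>y. \<mu> y $ r) (points F)" for r
  have y: "y r \<in> hom_Ga j F" if "r < n" for r
    using F.coord_in_hom_Ga[OF that] by (simp add: y_def)
  define \<phi> where "\<phi> x = F.unchart (vec n (\<lambda>r. u (y r) x))" for x
  have \<mu>\<phi>: "\<mu> (\<phi> x) = vec n (\<lambda>r. u (y r) x)" and \<phi>_in: "\<phi> x \<in> points F" for x
    by (simp_all add: \<phi>_def)
  show ?thesis
  proof
    show "alg_hom E F \<phi>"
    proof (rule alg_hom_by_coordinates[OF assms(1,2)])
      fix r assume "r < n"
      thus "restrict (\<lambda>x. \<mu> (\<phi> x) $ r) (points E) \<in> hom_Ga j E"
        using u_in[OF y] E.hom_Ga_restrict[of "u (y r)"] by (simp add: \<mu>\<phi>)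
    qed (rule \<phi>_in)
  next
    fix f x assume "f \<in> hom_Ga j F" and x: "x \<in> points E"
    thus "u f x = f (\<phi> x)"
    proof (induction rule: F.hom_Ga_induct)
      case zero
      have "u (restrict (\<lambda>_. 0) (points F)) x = 0"
        using u_scale[OF F.zero_in_hom_Ga x, of 0] by simp
      moreover have "restrict (\<lambda>_. 0) (points F) (\<phi> x) = 0" using \<phi>_in by simp
      ultimately show ?case by metis
    next
      case (coord r)
      hence "y r (\<phi> x) = u (y r) x" unfolding y_def[of r] using \<phi>_in by (simp add: \<mu>\<phi> y_def)
      thus ?case by (simp only: y_def)
    qed (auto simp: u_add u_scale u_tau x \<phi>_in)
  qed
qed

text \<open>
  If \<open>n > d\<close>, padding both factors with zeros to square matrices of size \<open>n\<close> gives a factorization of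
  the identity whose product in the other order has a zero row.
\<close>

lemma identity_factorization_dim_le:
  fixes a b :: "nat \<Rightarrow> nat \<Rightarrow> 'k"
  assumes "\<And>r r'. r < n \<Longrightarrow> r' < n \<Longrightarrow> (\<Sum>c<d. a r c * b c r') = (if r = r' then 1 else 0)"
  shows "n \<le> d"
proof (rule ccontr)
  assume "\<not> n \<le> d"
  hence dn: "d < n" by simp
  define P where "P = mat n n (\<lambda>(r, c). if c < d then a r c else 0)"
  define S where "S = mat n n (\<lambda>(c, r). if c < d then b c r else 0)"
  have P: "P \<in> carrier_mat n n" and S: "S \<in> carrier_mat n n" by (auto simp: P_def S_def)
  have "P * S = 1\<^sub>m n"
  proof (rule eq_matI)
    fix r r' assume r: "r < dim_row (1\<^sub>m n :: 'k mat)" "r' < dim_col (1\<^sub>m n :: 'k mat)"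
    have "(P * S) $$ (r, r') = (\<Sum>c\<in>{0..<n}. (if c < d then a r c else 0) * (if c < d then b c r' else 0))"
      using r by (simp add: P_def S_def scalar_prod_def)
    also have "\<dots> = (\<Sum>c<d. a r c * b c r')"
      using dn by (intro sum.mono_neutral_cong_right) auto
    also have "\<dots> = (1\<^sub>m n) $$ (r, r')" using assms r by simp
    finally show "(P * S) $$ (r, r') = (1\<^sub>m n) $$ (r, r')" .
  qed (auto simp: P_def S_def)
  hence "S * P = 1\<^sub>m n" by (rule mat_mult_left_right_inverse[OF P S])
  hence "(S * P) $$ (d, d) = 1" using dn by simp
  moreover have "(S * P) $$ (d, d) = 0"
    using dn by (simp add: P_def S_def scalar_prod_def)
  ultimately show False by simp
qed

text \<open>
  The coordinates of both maps are sums of polynomials in one variable without constant term. Taking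
  linear coefficients in \<open>\<phi> \<circ> \<psi> = id\<close> turns composition into multiplication of matrices, so the
  identity matrix of size \<open>n\<close> factors through dimension \<open>d\<close>.
\<close>

lemma dim_le_if_retraction:
  fixes \<kappa> :: "'e \<Rightarrow> 'k vec" and \<mu> :: "'f \<Rightarrow> 'k vec"
  assumes "vector_group j d E \<kappa>" and "vector_group j n F \<mu>"
    and \<phi>: "alg_hom E F \<phi>" and \<psi>: "alg_hom F E \<psi>"
    and inv: "\<And>y. y \<in> points F \<Longrightarrow> \<phi> (\<psi> y) = y"
  shows "n \<le> d"
proof -
  interpret E: vector_group j d E \<kappa> by fact
  interpret F: vector_group j n F \<mu> by fact
  have \<psi>_in: "\<psi> y \<in> points E" if "y \<in> points F" for y
    using \<psi> that by (auto simp: alg_hom_def)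
  have \<phi>_in: "\<phi> x \<in> points F" if "x \<in> points E" for x
    using \<phi> that by (auto simp: alg_hom_def)
  have q0: "CARD('q) ^ e \<noteq> 0" for e using finite_field_card_gt_1[where 'q='q] by simp
  have "\<exists>p. (\<forall>c<d. poly (p c) 0 = 0) \<and> (\<forall>x\<in>points E. \<mu> (\<phi> x) $ r = (\<Sum>c<d. poly (p c) (\<kappa> x $ c)))"
    if rn: "r < n" for r
  proof -
    obtain p where p: "\<And>c n. c < d \<Longrightarrow> coeff (p c) n \<noteq> 0 \<Longrightarrow> \<exists>e. n = CARD('q) ^ e"
      "\<And>x. x \<in> points E \<Longrightarrow> restrict (restrict (\<lambda>y. \<mu> y $ r) (points F) \<circ> \<phi>) (points E) x = (\<Sum>c<d. poly (p c) (\<kappa> x $ c))"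
      using E.hom_Ga_decomp[OF E.compose_in_hom_Ga[OF \<phi> F.coord_in_hom_Ga[OF rn]]] by metis
    have "poly (p c) 0 = 0" if "c < d" for c
      using p(1)[OF that, of 0] q0 by (metis poly_0_coeff_0)
    thus ?thesis
      using p(2) \<phi>_in by (intro exI[of _ p]) simp
  qed
  then obtain p where p0: "\<And>r c. r < n \<Longrightarrow> c < d \<Longrightarrow> poly (p r c) 0 = 0"
    and p: "\<And>r x. r < n \<Longrightarrow> x \<in> points E \<Longrightarrow> \<mu> (\<phi> x) $ r = (\<Sum>c<d. poly (p r c) (\<kappa> x $ c))"
    by metis
  have "\<exists>s. (\<forall>r<n. poly (s r) 0 = 0) \<and> (\<forall>y\<in>points F. \<kappa> (\<psi> y) $ c = (\<Sum>r<n. poly (s r) (\<mu> y $ r)))"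
    if cd: "c < d" for c
  proof -
    obtain s where s: "\<And>r m. r < n \<Longrightarrow> coeff (s r) m \<noteq> 0 \<Longrightarrow> \<exists>e. m = CARD('q) ^ e"
      "\<And>y. y \<in> points F \<Longrightarrow> restrict (restrict (\<lambda>x. \<kappa> x $ c) (points E) \<circ> \<psi>) (points F) y = (\<Sum>r<n. poly (s r) (\<mu> y $ r))"
      using F.hom_Ga_decomp[OF F.compose_in_hom_Ga[OF \<psi> E.coord_in_hom_Ga[OF cd]]] by metis
    have "poly (s r) 0 = 0" if "r < n" for r
      using s(1)[OF that, of 0] q0 by (metis poly_0_coeff_0)
    thus ?thesis
      using s(2) \<psi>_in by (intro exI[of _ s]) simp
  qed
  then obtain s where s0: "\<And>c r. c < d \<Longrightarrow> r < n \<Longrightarrow> poly (s c r) 0 = 0"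
    and s: "\<And>c y. c < d \<Longrightarrow> y \<in> points F \<Longrightarrow> \<kappa> (\<psi> y) $ c = (\<Sum>r<n. poly (s c r) (\<mu> y $ r))"
    by metis
  have coeff1: "coeff f 1 = poly (pderiv f) 0" for f :: "'k poly"
    by (simp add: poly_0_coeff_0 coeff_pderiv)
  show ?thesis
  proof (rule identity_factorization_dim_le)
    fix r r' assume r: "r < n" "r' < n"
    have "(\<Sum>c<d. pcompose (p r c) (s c r')) = (if r = r' then [:0, 1:] else 0)"
    proof (rule poly_eqI_K)
      fix u
      define y where "y = F.unchart (u \<cdot>\<^sub>v unit_vec n r')"
      have y: "y \<in> points F" "\<mu> y = u \<cdot>\<^sub>v unit_vec n r'" by (simp_all add: y_def)
      have k: "\<kappa> (\<psi> y) $ c = poly (s c r') u" if "c < d" for c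
      proof -
        have "\<kappa> (\<psi> y) $ c = (\<Sum>r''<n. if r'' = r' then poly (s c r') u else 0)"
          unfolding s[OF that y(1)] using r s0[OF that] by (intro sum.cong) (auto simp: y(2))
        thus ?thesis using r by simp
      qed
      have "poly (\<Sum>c<d. pcompose (p r c) (s c r')) u = \<mu> (\<phi> (\<psi> y)) $ r"
        using r by (simp add: p \<psi>_in y(1) k poly_sum poly_pcompose)
      also have "\<dots> = poly (if r = r' then [:0, 1:] else 0) u"
        using r by (simp add: inv y)
      finally show "poly (\<Sum>c<d. pcompose (p r c) (s c r')) u = poly (if r = r' then [:0, 1:] else 0) u" .
    qed
    hence "coeff (\<Sum>c<d. pcompose (p r c) (s c r')) 1 = (if r = r' then 1 else 0)"
      by simp
    also have "coeff (\<Sum>c<d. pcompose (p r c) (s c r')) 1 = (\<Sum>c<d. coeff (p r c) 1 * coeff (s c r') 1)"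
      unfolding coeff_sum
    proof (rule sum.cong)
      fix c assume "c \<in> {..<d}"
      thus "coeff (pcompose (p r c) (s c r')) 1 = coeff (p r c) 1 * coeff (s c r') 1"
        unfolding coeff1 using r s0 by (simp add: pderiv_pcompose poly_pcompose)
    qed simp
    finally show "(\<Sum>c<d. coeff (p r c) 1 * coeff (s c r') 1) = (if r = r' then 1 else 0)" .
  qed
qed

text \<open>
  The realizations of \<open>u\<close> and of its inverse are inverse to each other because functions in the
  motive separate points. For the same reason the realization commutes with \<open>t\<close>.
\<close>

lemma motive_iso_realized:
  fixes E :: "('q, 'k, 'e) alg_group" and F :: "('q, 'k, 'f) alg_group"
    and \<kappa> :: "'e \<Rightarrow> 'k vec" and \<mu> :: "'f \<Rightarrow> 'k vec"
  assumes E: "vector_group j d E \<kappa>" and F: "vector_group j n F \<mu>"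
    and \<Phi>: "alg_hom E E (\<Phi> t_var)" and \<Psi>: "alg_hom F F (\<Psi> t_var)"
    and u: "skew_module_iso (motive j F \<Psi>) (motive j E \<Phi>) u"
  shows "n = d \<and> (\<exists>\<phi>. alg_iso E F \<phi> \<and> (\<forall>x\<in>points E. \<phi> (\<Phi> t_var x) = \<Psi> t_var (\<phi> x)))"
proof -
  interpret E: vector_group j d E \<kappa> by fact
  interpret F: vector_group j n F \<mu> by fact
  define w where "w = inv_into (hom_Ga j F) u"
  have bij: "bij_betw u (hom_Ga j F) (hom_Ga j E)"
    using u by (simp add: skew_module_iso_def motive_simps)
  have w: "skew_module_iso (motive j E \<Phi>) (motive j F \<Psi>) w"
    using skew_module_iso_trans_inv[OF skew_module_iso_refl u F.closed_motive[of \<Psi>, OF \<Psi>]]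
    by (simp add: w_def[abs_def] motive_simps)
  obtain \<phi> where \<phi>: "alg_hom E F \<phi>"
    and u\<phi>: "\<And>f x. f \<in> hom_Ga j F \<Longrightarrow> x \<in> points E \<Longrightarrow> u f x = f (\<phi> x)"
    using motive_morphism_realized[OF E F u] by blast
  obtain \<psi> where \<psi>: "alg_hom F E \<psi>"
    and w\<psi>: "\<And>f y. f \<in> hom_Ga j E \<Longrightarrow> y \<in> points F \<Longrightarrow> w f y = f (\<psi> y)"
    using motive_morphism_realized[OF F E w] by blast
  have \<psi>_in: "\<psi> y \<in> points E" if "y \<in> points F" for y
    using \<psi> that by (auto simp: alg_hom_def)
  have \<phi>_in: "\<phi> x \<in> points F" if "x \<in> points E" for x
    using \<phi> that by (auto simp: alg_hom_def)
  have u_in: "u f \<in> hom_Ga j E" if "f \<in> hom_Ga j F" for f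
    using bij that by (auto simp: bij_betw_def)
  have w_in: "w f \<in> hom_Ga j F" if "f \<in> hom_Ga j E" for f
    using bij_betw_inv_into[OF bij] that by (auto simp: bij_betw_def w_def)
  have wu: "w (u f) = f" if "f \<in> hom_Ga j F" for f
    using bij_betw_inv_into_left[OF bij that] by (simp add: w_def)
  have uw: "u (w f) = f" if "f \<in> hom_Ga j E" for f
    using bij_betw_inv_into_right[OF bij that] by (simp add: w_def)
  have E_eqI: "x = x'" if "x \<in> points E" "x' \<in> points E" "\<And>f. f \<in> hom_Ga j E \<Longrightarrow> f x = f x'" for x x'
  proof (rule E.chart_inj[OF that(1,2)], rule eq_vecI)
    fix r assume "r < dim_vec (\<kappa> x')"
    thus "\<kappa> x $ r = \<kappa> x' $ r"
      using that(3)[OF E.coord_in_hom_Ga, of r] that(1,2) by simp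
  qed (use that in simp)
  have F_eqI: "x = x'" if "x \<in> points F" "x' \<in> points F" "\<And>f. f \<in> hom_Ga j F \<Longrightarrow> f x = f x'" for x x'
  proof (rule F.chart_inj[OF that(1,2)], rule eq_vecI)
    fix r assume "r < dim_vec (\<mu> x')"
    thus "\<mu> x $ r = \<mu> x' $ r"
      using that(3)[OF F.coord_in_hom_Ga, of r] that(1,2) by simp
  qed (use that in simp)
  have \<psi>\<phi>: "\<psi> (\<phi> x) = x" if "x \<in> points E" for x
    using that by (intro E_eqI) (simp_all add: \<phi>_in \<psi>_in w_in uw flip: w\<psi> u\<phi>)
  have \<phi>\<psi>: "\<phi> (\<psi> y) = y" if "y \<in> points F" for y
    using that by (intro F_eqI) (simp_all add: \<phi>_in \<psi>_in u_in wu flip: w\<psi> u\<phi>)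
  have "n = d"
    using dim_le_if_retraction[OF E F \<phi> \<psi> \<phi>\<psi>] dim_le_if_retraction[OF F E \<psi> \<phi> \<psi>\<phi>] by simp
  moreover have "alg_iso E F \<phi>"
    unfolding alg_iso_def
  proof (intro conjI \<phi>)
    show b: "bij_betw \<phi> (points E) (points F)"
      by (rule bij_betw_byWitness[of _ \<psi>]) (auto simp: \<phi>\<psi> \<psi>\<phi> \<phi>_in \<psi>_in)
    have "inv_into (points E) \<phi> y = \<psi> y" if "y \<in> points F" for y
      using bij_betw_inv_into_left[OF b \<psi>_in[OF that]] by (simp add: \<phi>\<psi> that)
    hence "restrict (f \<circ> inv_into (points E) \<phi>) (points F) = restrict (f \<circ> \<psi>) (points F)"
      "y \<in> points F \<Longrightarrow> inv_into (points E) \<phi> y = \<psi> y" for f :: "'e \<Rightarrow> 'k" and y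
      by (auto intro: restrict_ext)
    thus "alg_hom F E (inv_into (points E) \<phi>)"
      using \<psi> by (simp add: alg_hom_def Pi_iff)
  qed
  moreover have "\<phi> (\<Phi> t_var x) = \<Psi> t_var (\<phi> x)" if x: "x \<in> points E" for x
  proof (rule F_eqI)
    have \<Phi>x: "\<Phi> t_var x \<in> points E" using \<Phi> x by (auto simp: alg_hom_def)
    have \<Psi>x: "\<Psi> t_var y \<in> points F" if "y \<in> points F" for y using \<Psi> that by (auto simp: alg_hom_def)
    show "\<phi> (\<Phi> t_var x) \<in> points F" "\<Psi> t_var (\<phi> x) \<in> points F"
      using \<Phi>x \<Psi>x \<phi>_in x by auto
    fix f assume f: "f \<in> hom_Ga j F"
    have eq: "u (restrict (act (\<Psi> t_var) [:0, 1:] f) (points F)) = restrict (act (\<Phi> t_var) [:0, 1:] (u f)) (points E)"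
      using u f unfolding skew_module_iso_def motive_simps by blast
    have "restrict (act (\<Psi> t_var) [:0, 1:] f) (points F) (\<phi> x) = u (restrict (act (\<Psi> t_var) [:0, 1:] f) (points F)) x"
      by (rule u\<phi>[symmetric, OF F.act_in_hom_Ga[OF \<Psi> f] x])
    also have "\<dots> = u f (\<Phi> t_var x)"
      unfolding eq using x by simp
    finally have "restrict (act (\<Psi> t_var) [:0, 1:] f) (points F) (\<phi> x) = u f (\<Phi> t_var x)" .
    thus "f (\<phi> (\<Phi> t_var x)) = f (\<Psi> t_var (\<phi> x))"
      using x f \<Phi>x \<phi>_in by (simp add: u\<phi>)
  qed
  ultimately show ?thesis by blast
qed

end

section \<open>Polynomials in t acting on functions\<close>

lemma act_eq_sum: "degree a \<le> n \<Longrightarrow> act S a m x = (\<Sum>i\<le>n. coeff a i * m ((S ^^ i) x))"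
  unfolding act_def by (intro sum.mono_neutral_left) (auto simp: coeff_eq_0)

lemma act_0 [simp]: "act S 0 m x = 0"
  by (simp add: act_def)

lemma act_1 [simp]: "act S 1 m x = m x"
  by (simp add: act_def)

lemma act_pCons: "act S (pCons c a) m x = c * m x + act S a m (S x)"
proof -
  have "act S (pCons c a) m x = (\<Sum>i\<le>Suc (degree a). coeff (pCons c a) i * m ((S ^^ i) x))"
    by (intro act_eq_sum) (simp add: degree_pCons_le)
  also have "\<dots> = c * m x + (\<Sum>i\<le>degree a. coeff a i * m ((S ^^ Suc i) x))"
    by (subst sum.atMost_Suc_shift) simp
  finally show ?thesis by (simp add: act_def funpow_swap1)
qed

lemma act_add_left: "act S (a + b) m x = act S a m x + act S b m x"
proof -
  define n where "n = max (degree a) (degree b)"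
  have "degree a \<le> n" "degree b \<le> n" "degree (a + b) \<le> n"
    using degree_add_le_max[of a b] by (auto simp: n_def)
  thus ?thesis by (simp add: act_eq_sum[of _ n] sum.distrib algebra_simps)
qed

lemma act_smult: "act S (smult c a) m x = c * act S a m x"
  using act_eq_sum[of "smult c a" "degree a" S m x] 
  by (simp add: act_def sum_distrib_left mult.assoc)

lemma act_sum_right: "act S a (\<lambda>x. \<Sum>i\<in>I. f i x) x = (\<Sum>i\<in>I. act S a (f i) x)"
  unfolding act_def sum_distrib_left by (rule sum.swap)

lemma act_mult: "act S (a * b) m x = act S a (act S b m) x"
proof (induction a arbitrary: x)
  case (pCons c a)
  show ?case by (simp add: act_add_left act_smult act_pCons pCons)
qed simp

lemma act_cong:
  assumes "x \<in> X" "\<And>y. y \<in> X \<Longrightarrow> S y \<in> X" "\<And>y. y \<in> X \<Longrightarrow> m y = m' y"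
  shows "act S a m x = act S a m' x"
proof -
  have "(S ^^ i) x \<in> X" for i by (induction i) (use assms in auto)
  thus ?thesis by (simp add: act_def assms(3))
qed

text \<open>
  Reindexed by the exponent of the result, the hyperderivative has no truncated subtraction, and the
  rule for multiplying by \<open>t\<close> becomes Pascal's rule.
\<close>

lemma coeff_hyperderiv: "coeff (hyperderiv n a) e = coeff a (e + n) * of_nat ((e + n) choose n)"
proof -
  have "coeff (hyperderiv n a) e =
      (\<Sum>i\<le>degree a. if i = e + n then coeff a i * of_nat (i choose n) else 0)"
    unfolding hyperderiv_def coeff_sum by (intro sum.cong) (auto simp: binomial_eq_0)
  also have "\<dots> = coeff a (e + n) * of_nat ((e + n) choose n)"
    by (auto simp: coeff_eq_0)
  finally show ?thesis .
qed

lemma hyperderiv_0 [simp]: "hyperderiv n 0 = 0"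
  by (simp add: hyperderiv_def)

lemma hyperderiv_pCons:
  "hyperderiv 0 (pCons c a) = pCons c (hyperderiv 0 a)"
  "hyperderiv (Suc n) (pCons c a) = pCons 0 (hyperderiv (Suc n) a) + hyperderiv n a"
  by (auto intro!: poly_eqI simp: coeff_hyperderiv coeff_pCons binomial_eq_0 algebra_simps split: nat.splits)

lemma lookup_fscale: "Poly_Mapping.lookup (fscale a f) p = a * Poly_Mapping.lookup f p"
  by (simp add: fscale_def map.rep_eq when_def)

interpretation free: Modules.module "fscale :: 'k::field poly \<Rightarrow> ((nat \<times> 'm) \<Rightarrow>\<^sub>0 'k poly) \<Rightarrow> _"
  by unfold_locales
     (auto intro!: poly_mapping_eqI simp: lookup_fscale lookup_add algebra_simps)

lemma keys_fscale_subset: "Poly_Mapping.keys (fscale a f) \<subseteq> Poly_Mapping.keys f"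
  by (auto simp: in_keys_iff lookup_fscale)

lemma lookup_D: "Poly_Mapping.lookup (D i m) p = (if p = (i, m) then 1 else 0)"
  by (auto simp: D_def lookup_single)

lemma poly_mapping_D_expansion:
  "f = (\<Sum>p\<in>Poly_Mapping.keys f. fscale (Poly_Mapping.lookup f p) (D (fst p) (snd p)))"
  by (rule poly_mapping_eqI)
     (auto simp: lookup_sum lookup_fscale lookup_D in_keys_iff if_distrib[of "(*) _"] cong: if_cong)

section \<open>Realizing the prolongation by functions of a block vector\<close>

definition vec_block :: "nat \<Rightarrow> nat \<Rightarrow> 'a vec \<Rightarrow> 'a vec" where
  "vec_block d i x = vec d (\<lambda>r. x $ (i * d + r))"

lemma vec_block_carrier [simp]: "vec_block d i x \<in> carrier_vec d"
  and dim_vec_block [simp]: "dim_vec (vec_block d i x) = d"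
  by (simp_all add: vec_block_def)

lemma mod_block [simp]: "r < d \<Longrightarrow> (I * d + r) mod d = r"
  for d :: nat by auto

lemma block_bound:
  fixes d :: nat
  assumes "I < n" "r < d"
  shows "I * d + r < n * d"
proof -
  have "I * d + r < Suc I * d" using assms by simp
  also have "\<dots> \<le> n * d" using assms by (intro mult_le_mono1) simp
  finally show ?thesis .
qed

locale prolongation = vector_group j d E \<kappa>
  for j :: "'q::{finite,field} poly fract \<Rightarrow> 'k::field"
    and d :: nat and E :: "('q, 'k, 'e) alg_group" and \<kappa> :: "'e \<Rightarrow> 'k vec" +
  fixes \<Phi> :: "'q poly \<Rightarrow> 'e \<Rightarrow> 'e" and k :: nat
  assumes alg_hom_t: "alg_hom E E (\<Phi> t_var)"
begin

definition N :: nat where "N = d * (k + 1)"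

abbreviation blk :: "nat \<Rightarrow> 'k vec \<Rightarrow> 'k vec" where "blk \<equiv> vec_block d"

definition single_block :: "nat \<Rightarrow> 'k vec \<Rightarrow> 'k vec" where
  "single_block i v = vec N (\<lambda>R. if R div d = i then v $ (R mod d) else 0)"

text \<open>
  Block \<open>i\<close> of \<open>T x\<close> is \<open>t x\<^sub>i - x\<^sub>i\<^sub>-\<^sub>1\<close>, with \<open>t x\<^sub>i\<close> computed in \<open>E\<close> and nothing subtracted for \<open>i = 0\<close>; row \<open>R - d\<close> is the row of the preceding block that
  corresponds to row \<open>R\<close>.
\<close>

definition T :: "'k vec \<Rightarrow> 'k vec" where
  "T x = vec N (\<lambda>R. \<kappa> (\<Phi> t_var (unchart (blk (R div d) x))) $ (R mod d)
     - (if R div d = 0 then 0 else x $ (R - d)))"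

text \<open>The function that realizes the symbol \<open>D\<^sub>i m\<close>.\<close>

definition \<delta> :: "nat \<Rightarrow> ('e \<Rightarrow> 'k) \<Rightarrow> 'k vec \<Rightarrow> 'k" where
  "\<delta> i m x = m (unchart (blk i x))"

definition realize :: "((nat \<times> ('e \<Rightarrow> 'k)) \<Rightarrow>\<^sub>0 'k poly) \<Rightarrow> 'k vec \<Rightarrow> 'k" where
  "realize f x = (\<Sum>p\<in>Poly_Mapping.keys f. act T (Poly_Mapping.lookup f p) (\<delta> (fst p) (snd p)) x)"

lemma t_in [simp]: "x \<in> points E \<Longrightarrow> \<Phi> t_var x \<in> points E"
  using alg_hom_t by (auto simp: alg_hom_def)

lemma single_block_in [simp]: "single_block i v \<in> carrier_vec N"
  by (simp add: single_block_def)

lemma T_in [simp]: "T x \<in> carrier_vec N"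
  by (simp add: T_def)

lemma block_index_less: "i \<le> k \<Longrightarrow> r < d \<Longrightarrow> i * d + r < N"
  using block_bound[of i "k + 1" r d] by (simp add: N_def mult.commute)

lemma block_index_cases:
  assumes "R < N"
  shows "R div d \<le> k" "R mod d < d"
proof -
  have "d > 0" using assms by (auto simp: N_def intro: Nat.gr0I)
  thus "R mod d < d" by simp
  have "R div d < k + 1"
    by (rule less_mult_imp_div_less) (use assms in \<open>simp add: N_def mult.commute\<close>)
  thus "R div d \<le> k" by simp
qed

lemma blk_single_block:
  assumes "i' \<le> k" "v \<in> carrier_vec d"
  shows "blk i' (single_block i v) = (if i' = i then v else 0\<^sub>v d)"
  using assms by (intro eq_vecI) (auto simp: vec_block_def single_block_def block_index_less)

lemma blk_T:
  assumes "i \<le> k"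
  shows "blk i (T x) = \<kappa> (\<Phi> t_var (unchart (blk i x))) - (if i = 0 then 0\<^sub>v d else blk (i - 1) x)"
proof (rule eq_vecI)
  fix r assume "r < dim_vec (\<kappa> (\<Phi> t_var (unchart (blk i x))) - (if i = 0 then 0\<^sub>v d else blk (i - 1) x))"
  hence r: "r < d" by (auto split: if_splits simp: vec_block_def)
  have "i * d + r - d = (i - 1) * d + r" if "i \<noteq> 0"
    using that by (cases i) auto
  thus "blk i (T x) $ r = (\<kappa> (\<Phi> t_var (unchart (blk i x))) - (if i = 0 then 0\<^sub>v d else blk (i - 1) x)) $ r"
    using r assms by (auto simp: vec_block_def T_def block_index_less)
qed (auto simp: vec_block_def)

lemma hom_Ga_unchart_diff:
  assumes m: "m \<in> hom_Ga j E" and "v \<in> carrier_vec d" "w \<in> carrier_vec d"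
  shows "m (unchart (v - w)) = m (unchart v) - m (unchart w)"
proof -
  have "m (unchart v) = m (unchart ((v - w) + w))"
    using assms by (intro arg_cong[of _ _ "\<lambda>v. m (unchart v)"] eq_vecI) auto
  also have "\<dots> = m (unchart (v - w)) + m (unchart w)"
    using assms by (subst unchart_add) (auto simp: hom_Ga_add)
  finally show ?thesis by simp
qed

lemma hom_Ga_unchart_0: "m \<in> hom_Ga j E \<Longrightarrow> m (unchart (0\<^sub>v d)) = 0"
  using hom_Ga_unchart_diff[of m "0\<^sub>v d" "0\<^sub>v d"] by simp

text \<open>
  This is the relation \<open>t D\<^sub>i m = D\<^sub>i(t m) - D\<^sub>i\<^sub>-\<^sub>1 m\<close>, which \<open>T\<close> is made to satisfy.
\<close>

lemma \<delta>_T: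
  assumes "i \<le> k" "m \<in> hom_Ga j E"
  shows "\<delta> i m (T x) = m (\<Phi> t_var (unchart (blk i x))) - (if i = 0 then 0 else \<delta> (i - 1) m x)"
  using assms by (simp add: \<delta>_def blk_T hom_Ga_unchart_diff hom_Ga_unchart_0)

text \<open>
  Induction on \<open>a\<close>, replacing \<open>a\<close> by \<open>c + t a\<close>: the function \<open>a m\<close> lies in the motive, so \<open>\<delta>_T\<close> applies to
  it, and the result matches the recursion of the hyperderivatives.
\<close>

lemma leibniz:
  assumes m: "m \<in> hom_Ga j E" and "i \<le> k"
  shows "act (\<Phi> t_var) a m (unchart (blk i x)) = (\<Sum>l\<le>i. act T (hyperderiv l a) (\<delta> (i - l) m) x)"
  using \<open>i \<le> k\<close>
proof (induction a arbitrary: i x)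
  case 0
  show ?case by simp
next
  case (pCons c a)
  define g where "g = restrict (act (\<Phi> t_var) a m) (points E)"
  have g: "g \<in> hom_Ga j E" unfolding g_def by (rule act_in_hom_Ga[OF alg_hom_t m])
  have \<delta>g: "\<delta> i g y = (\<Sum>l\<le>i. act T (hyperderiv l a) (\<delta> (i - l) m) y)" if "i \<le> k" for i y
    by (subst \<delta>_def) (use pCons.IH[OF that, of y] in \<open>simp add: g_def\<close>)
  have "act (\<Phi> t_var) (pCons c a) m (unchart (blk i x)) = c * \<delta> i m x + g (\<Phi> t_var (unchart (blk i x)))"
    by (simp add: act_pCons g_def \<delta>_def)
  also have "g (\<Phi> t_var (unchart (blk i x))) = \<delta> i g (T x) + (if i = 0 then 0 else \<delta> (i - 1) g x)"
    using \<delta>_T[OF pCons.prems g, of x] by simp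
  finally have lhs: "act (\<Phi> t_var) (pCons c a) m (unchart (blk i x)) =
      c * \<delta> i m x + (\<delta> i g (T x) + (if i = 0 then 0 else \<delta> (i - 1) g x))" .
  show ?case
  proof (cases i)
    case 0
    thus ?thesis unfolding lhs by (simp add: \<delta>g hyperderiv_pCons act_pCons)
  next
    case (Suc i')
    have "(\<Sum>l\<le>i. act T (hyperderiv l (pCons c a)) (\<delta> (i - l) m) x) =
        c * \<delta> i m x + act T (hyperderiv 0 a) (\<delta> i m) (T x) +
        (\<Sum>l\<le>i'. act T (hyperderiv (Suc l) a) (\<delta> (i - Suc l) m) (T x) + act T (hyperderiv l a) (\<delta> (i' - l) m) x)"
      unfolding Suc sum.atMost_Suc_shift by (simp add: hyperderiv_pCons act_pCons act_add_left)
    also have "\<dots> = c * \<delta> i m x + (\<Sum>l\<le>i. act T (hyperderiv l a) (\<delta> (i - l) m) (T x))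
        + (\<Sum>l\<le>i'. act T (hyperderiv l a) (\<delta> (i' - l) m) x)"
      unfolding Suc sum.atMost_Suc_shift by (simp add: sum.distrib)
    also have "\<dots> = act (\<Phi> t_var) (pCons c a) m (unchart (blk i x))"
      unfolding lhs using pCons.prems Suc by (simp add: \<delta>g)
    finally show ?thesis by simp
  qed
qed

lemma realize_superset:
  assumes "finite A" "Poly_Mapping.keys f \<subseteq> A"
  shows "realize f x = (\<Sum>p\<in>A. act T (Poly_Mapping.lookup f p) (\<delta> (fst p) (snd p)) x)"
  unfolding realize_def using assms by (intro sum.mono_neutral_left) (auto simp: in_keys_iff)

lemma realize_0 [simp]: "realize 0 x = 0"
  by (simp add: realize_def)

lemma realize_add: "realize (f + g) x = realize f x + realize g x"
proof -
  define A where "A = Poly_Mapping.keys f \<union> Poly_Mapping.keys g"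
  have "finite A" "Poly_Mapping.keys f \<subseteq> A" "Poly_Mapping.keys g \<subseteq> A" "Poly_Mapping.keys (f + g) \<subseteq> A"
    using Poly_Mapping.keys_add[of f g] by (auto simp: A_def)
  thus ?thesis by (simp add: realize_superset[of A] lookup_add act_add_left sum.distrib)
qed

lemma realize_fscale: "realize (fscale a f) x = act T a (realize f) x"
  unfolding realize_superset[OF finite_keys keys_fscale_subset, of a f]
  by (simp add: lookup_fscale act_mult realize_def[abs_def] act_sum_right)

lemma realize_diff: "realize (f - g) x = realize f x - realize g x"
  using realize_add[of "f - g" g x] by simp

lemma realize_sum: "realize (\<Sum>i\<in>I. f i) x = (\<Sum>i\<in>I. realize (f i) x)"
  by (induction I rule: infinite_finite_induct) (auto simp: realize_add)

lemma realize_D: "realize (D i m) = \<delta> i m"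
proof
  show "realize (D i m) x = \<delta> i m x" for x
    by (subst realize_superset[of "{(i, m)}"]) (auto simp: in_keys_iff lookup_D split: if_splits)
qed

abbreviation M where "M \<equiv> motive j E \<Phi>"

abbreviation Rel where "Rel \<equiv> free.span (prolong_relations k M)"

lemma realize_relation: "f \<in> Rel \<Longrightarrow> realize f x = 0"
proof -
  have "Rel \<subseteq> {f. \<forall>x. realize f x = 0}"
  proof (rule free.span_minimal)
    show "prolong_relations k M \<subseteq> {f. \<forall>x. realize f x = 0}"
      unfolding prolong_relations_def motive_simps
      by (auto simp: realize_diff realize_add realize_D realize_sum realize_fscale leibniz[symmetric]) (auto simp: \<delta>_def)
    show "free.subspace {f. \<forall>x. realize f x = 0}"
      by (rule free.subspaceI) (auto simp: realize_add realize_fscale act_def)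
  qed
  thus "f \<in> Rel \<Longrightarrow> realize f x = 0" by blast
qed

lemma rel_add:
  "i \<le> k \<Longrightarrow> m \<in> hom_Ga j E \<Longrightarrow> m' \<in> hom_Ga j E \<Longrightarrow> D i (madd M m m') - (D i m + D i m') \<in> Rel"
  by (rule free.span_base) (unfold prolong_relations_def motive_simps(1), blast)

lemma rel_scale:
  "i \<le> k \<Longrightarrow> m \<in> hom_Ga j E \<Longrightarrow>
    D i (mscale M a m) - (\<Sum>l\<le>i. fscale (hyperderiv l a) (D (i - l) m)) \<in> Rel"
  by (rule free.span_base) (unfold prolong_relations_def motive_simps(1), blast)

lemma rel_const:
  assumes "i \<le> k" "m \<in> hom_Ga j E"
  shows "D i (mscale M [:c:] m) - fscale [:c:] (D i m) \<in> Rel"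
proof -
  have h: "hyperderiv l [:c:] = (if l = 0 then [:c:] else 0)" for l
    by (cases l) (simp_all add: hyperderiv_pCons)
  have "(\<Sum>l\<le>i. fscale (hyperderiv l [:c:]) (D (i - l) m)) =
      (\<Sum>l\<le>i. if l = 0 then fscale [:c:] (D i m) else 0)"
    by (intro sum.cong) (auto simp: h)
  thus ?thesis using rel_scale[OF assms, of "[:c:]"] by simp
qed

lemma rel_t:
  assumes "i \<le> k" "m \<in> hom_Ga j E"
  shows "D i (mscale M [:0, 1:] m) - (fscale [:0, 1:] (D i m) + (if i = 0 then 0 else D (i - 1) m)) \<in> Rel"
proof -
  have h: "hyperderiv l [:0, 1:] = (if l = 0 then [:0, 1:] else if l = 1 then 1 else (0 :: 'k poly))" for l
    by (cases l; cases "l - 1") (simp_all add: hyperderiv_pCons one_pCons)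
  have "(\<Sum>l\<le>i. fscale (hyperderiv l [:0, 1:]) (D (i - l) m)) =
      (\<Sum>l\<le>i. (if l = 0 then fscale [:0, 1 :: 'k:] (D i m) else 0) + (if l = 1 then D (i - 1) m else 0))"
    by (intro sum.cong) (auto simp: h)
  also have "\<dots> = fscale [:0, 1:] (D i m) + (if i = 0 then 0 else D (i - 1) m)"
    by (simp add: sum.distrib)
  finally show ?thesis using rel_scale[OF assms, of "[:0, 1:]"] by simp
qed

definition zero_fun :: "'e \<Rightarrow> 'k" where "zero_fun = restrict (\<lambda>_. 0) (points E)"

lemma zero_fun_in: "zero_fun \<in> hom_Ga j E"
  by (simp add: zero_fun_def zero_in_hom_Ga)

lemma rel_zero:
  assumes "i \<le> k"
  shows "D i zero_fun \<in> Rel"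
proof -
  have "restrict (\<lambda>x. 0 * zero_fun x) (points E) = zero_fun"
    by (simp add: zero_fun_def)
  thus ?thesis
    using rel_const[OF assms zero_fun_in, of 0] act_const[of "\<Phi> t_var" 0 zero_fun]
    by (simp add: motive_simps)
qed

text \<open>
  The elements that are, modulo the relations, a sum of symbols with exactly one of each order. They
  form a \<open>K[t]\<close>-submodule that contains all symbols of order at most \<open>k\<close>, hence all of \<open>free_on k M\<close>.
\<close>

definition reducible :: "((nat \<times> ('e \<Rightarrow> 'k)) \<Rightarrow>\<^sub>0 'k poly) set" where
  "reducible = {f. \<exists>\<mu>. (\<forall>i\<le>k. \<mu> i \<in> hom_Ga j E) \<and> f - (\<Sum>i\<le>k. D i (\<mu> i)) \<in> Rel}"

lemma reducibleI: "(\<And>i. i \<le> k \<Longrightarrow> \<mu> i \<in> hom_Ga j E) \<Longrightarrow> f - (\<Sum>i\<le>k. D i (\<mu> i)) \<in> Rel \<Longrightarrow> f \<in> reducible"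
  unfolding reducible_def by (intro CollectI exI[of _ \<mu>]) simp

lemma reducible_cong: "g \<in> reducible \<Longrightarrow> f - g \<in> Rel \<Longrightarrow> f \<in> reducible"
proof -
  assume "g \<in> reducible" "f - g \<in> Rel"
  then obtain \<mu> where \<mu>: "\<forall>i\<le>k. \<mu> i \<in> hom_Ga j E" "g - (\<Sum>i\<le>k. D i (\<mu> i)) \<in> Rel"
    by (auto simp: reducible_def)
  from free.span_add[OF \<open>f - g \<in> Rel\<close> \<mu>(2)] \<mu>(1) show "f \<in> reducible"
    using reducibleI[of \<mu> f] by simp
qed

lemma reducible_add: 
  assumes "f \<in> reducible" "g \<in> reducible"
  shows "f + g \<in> reducible"
proof -
  obtain \<mu> \<nu> where \<mu>: "\<And>i. i \<le> k \<Longrightarrow> \<mu> i \<in> hom_Ga j E" "f - (\<Sum>i\<le>k. D i (\<mu> i)) \<in> Rel"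
    and \<nu>: "\<And>i. i \<le> k \<Longrightarrow> \<nu> i \<in> hom_Ga j E" "g - (\<Sum>i\<le>k. D i (\<nu> i)) \<in> Rel"
    using assms unfolding reducible_def by blast
  have "(\<Sum>i\<le>k. D i (madd M (\<mu> i) (\<nu> i)) - (D i (\<mu> i) + D i (\<nu> i))) \<in> Rel"
    by (intro free.span_sum rel_add) (auto simp: \<mu> \<nu>)
  from free.span_diff[OF free.span_add[OF \<mu>(2) \<nu>(2)] this]
  have "f + g - (\<Sum>i\<le>k. D i (madd M (\<mu> i) (\<nu> i))) \<in> Rel"
    by (simp add: sum_subtractf sum.distrib algebra_simps)
  moreover have "madd M (\<mu> i) (\<nu> i) \<in> hom_Ga j E" if "i \<le> k" for i
    using \<mu>(1) \<nu>(1) that by (simp add: motive_simps add_in_hom_Ga)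
  ultimately show ?thesis using reducibleI[of "\<lambda>i. madd M (\<mu> i) (\<nu> i)"] by simp
qed

lemma reducible_D:
  assumes "i \<le> k" "m \<in> hom_Ga j E"
  shows "D i m \<in> reducible"
proof -
  define \<mu> where "\<mu> l = (if l = i then m else zero_fun)" for l
  have "(\<Sum>l\<le>k. D l (\<mu> l)) = D i (\<mu> i) + (\<Sum>l\<in>{..k} - {i}. D l (\<mu> l))"
    using assms by (intro sum.remove) auto
  also have "(\<Sum>l\<in>{..k} - {i}. D l (\<mu> l)) = (\<Sum>l\<in>{..k} - {i}. D l zero_fun)"
    by (intro sum.cong) (auto simp: \<mu>_def)
  finally have eq: "(\<Sum>l\<le>k. D l (\<mu> l)) = D i m + (\<Sum>l\<in>{..k} - {i}. D l zero_fun)"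
    by (simp add: \<mu>_def)
  have "(\<Sum>l\<in>{..k} - {i}. D l zero_fun) \<in> Rel"
    by (intro free.span_sum rel_zero) auto
  hence "D i m - (\<Sum>l\<le>k. D l (\<mu> l)) \<in> Rel"
    unfolding eq using free.span_neg by fastforce
  moreover have "\<mu> l \<in> hom_Ga j E" for l using assms zero_fun_in by (auto simp: \<mu>_def)
  ultimately show ?thesis using reducibleI[of \<mu>] by simp
qed

lemma reducible_0: "0 \<in> reducible"
  by (rule reducible_cong[OF reducible_D[OF _ zero_fun_in, of 0]]) (use rel_zero[of 0] free.span_neg in auto)

lemma reducible_sum: "(\<And>i. i \<in> I \<Longrightarrow> f i \<in> reducible) \<Longrightarrow> (\<Sum>i\<in>I. f i) \<in> reducible"
  by (induction I rule: infinite_finite_induct) (auto simp: reducible_0 reducible_add)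

lemma reducible_fscale:
  assumes D: "\<And>i m. i \<le> k \<Longrightarrow> m \<in> hom_Ga j E \<Longrightarrow> fscale a (D i m) \<in> reducible" and f: "f \<in> reducible"
  shows "fscale a f \<in> reducible"
proof -
  obtain \<mu> where \<mu>: "\<And>i. i \<le> k \<Longrightarrow> \<mu> i \<in> hom_Ga j E" "f - (\<Sum>i\<le>k. D i (\<mu> i)) \<in> Rel"
    using f unfolding reducible_def by blast
  show ?thesis
  proof (rule reducible_cong)
    show "(\<Sum>i\<le>k. fscale a (D i (\<mu> i))) \<in> reducible"
      by (intro reducible_sum D \<mu>(1)) auto
    show "fscale a f - (\<Sum>i\<le>k. fscale a (D i (\<mu> i))) \<in> Rel"
      using free.span_scale[OF \<mu>(2), of a] by (simp add: free.scale_right_diff_distrib free.scale_sum_right)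
  qed
qed

lemma reducible_const: "f \<in> reducible \<Longrightarrow> fscale [:c:] f \<in> reducible"
proof (rule reducible_fscale)
  fix i m assume im: "i \<le> k" "m \<in> hom_Ga j E"
  have "D i (mscale M [:c:] m) \<in> reducible"
    using im act_in_hom_Ga[OF alg_hom_t] by (intro reducible_D) (simp_all only: motive_simps)
  thus "fscale [:c:] (D i m) \<in> reducible"
    by (rule reducible_cong) (use free.span_neg[OF rel_const[OF im, of c]] in simp)
qed

text \<open>
  The relation for \<open>t\<close>, read as \<open>t D\<^sub>i m = D\<^sub>i(t m) - D\<^sub>i\<^sub>-\<^sub>1 m\<close>, trades a factor \<open>t\<close> for symbols.
\<close>

lemma reducible_t: "f \<in> reducible \<Longrightarrow> fscale [:0, 1:] f \<in> reducible"
proof (rule reducible_fscale)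
  fix i m assume im: "i \<le> k" "m \<in> hom_Ga j E"
  have "D i (mscale M [:0, 1:] m) \<in> reducible"
    using im act_in_hom_Ga[OF alg_hom_t] by (intro reducible_D) (simp_all only: motive_simps)
  moreover have "(if i = 0 then 0 else D (i - 1) m) \<in> reducible"
    using im reducible_0 reducible_D by simp
  ultimately have "D i (mscale M [:0, 1:] m) + fscale [:-1:] (if i = 0 then 0 else D (i - 1) m) \<in> reducible"
    by (intro reducible_add reducible_const)
  moreover have "fscale [:-1:] f = - f" for f :: "(nat \<times> ('e \<Rightarrow> 'k)) \<Rightarrow>\<^sub>0 'k poly"
    by (rule poly_mapping_eqI) (simp add: lookup_fscale)
  ultimately have "D i (mscale M [:0, 1:] m) - (if i = 0 then 0 else D (i - 1) m) \<in> reducible"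
    by simp
  thus "fscale [:0, 1:] (D i m) \<in> reducible"
    by (rule reducible_cong) (use free.span_neg[OF rel_t[OF im]] in \<open>simp add: algebra_simps\<close>)
qed

lemma reducible_scale: "f \<in> reducible \<Longrightarrow> fscale a f \<in> reducible"
proof (induction a)
  case 0
  show ?case by (simp add: reducible_0)
next
  case (pCons c a)
  have "fscale (pCons c a) f = fscale [:c:] f + fscale [:0, 1:] (fscale a f)"
    by (rule poly_mapping_eqI) (simp add: lookup_fscale lookup_add)
  also have "\<dots> \<in> reducible" using pCons by (intro reducible_add reducible_const reducible_t)
  finally show ?case .
qed

lemma free_on_subset_reducible: "free_on k M \<subseteq> reducible"
proof
  fix f assume f: "f \<in> free_on k M"
  have "(\<Sum>p\<in>Poly_Mapping.keys f. fscale (Poly_Mapping.lookup f p) (D (fst p) (snd p))) \<in> reducible"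
    using f by (intro reducible_sum reducible_scale reducible_D) (auto simp: free_on_def motive_simps)
  thus "f \<in> reducible" using poly_mapping_D_expansion[of f] by simp
qed

text \<open>
  Reduce the element to a sum of \<open>D\<^sub>i m\<^sub>i\<close>. Its realization at the vector with the single nonzero block
  \<open>\<kappa> x\<close> in position \<open>i\<close> is \<open>m\<^sub>i(x)\<close>. So all \<open>m\<^sub>i\<close> are zero, and \<open>D\<^sub>i 0\<close> lies in the span of the relations.
\<close>

lemma realize_kernel:
  assumes "f \<in> free_on k M" "\<And>x. x \<in> carrier_vec N \<Longrightarrow> realize f x = 0"
  shows "f \<in> Rel"
proof -
  obtain \<mu> where \<mu>: "\<And>i. i \<le> k \<Longrightarrow> \<mu> i \<in> hom_Ga j E" "f - (\<Sum>i\<le>k. D i (\<mu> i)) \<in> Rel"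
    using assms free_on_subset_reducible unfolding reducible_def by blast
  have "\<mu> i = zero_fun" if i: "i \<le> k" for i
  proof (rule hom_Ga_eqI[OF \<mu>(1)[OF i] zero_fun_in])
    fix x assume x: "x \<in> points E"
    have "0 = realize f (single_block i (\<kappa> x))" by (simp add: assms)
    also have "\<dots> = (\<Sum>l\<le>k. \<delta> l (\<mu> l) (single_block i (\<kappa> x)))"
      using realize_relation[OF \<mu>(2), of "single_block i (\<kappa> x)"] by (simp add: realize_diff realize_sum realize_D)
    also have "\<dots> = (\<Sum>l\<le>k. if l = i then \<mu> i x else 0)"
      using x i by (intro sum.cong) (auto simp: \<delta>_def blk_single_block hom_Ga_unchart_0 \<mu>(1))
    also have "\<dots> = \<mu> i x" using i by simp
    finally show "\<mu> i x = zero_fun x" using x by (simp add: zero_fun_def)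
  qed
  hence "(\<Sum>i\<le>k. D i (\<mu> i)) = (\<Sum>i\<le>k. D i zero_fun)" by (intro sum.cong) auto
  also have "\<dots> \<in> Rel" by (intro free.span_sum rel_zero) auto
  finally show ?thesis using free.span_add[OF \<mu>(2)] by fastforce
qed

end

section \<open>The motive of the block group is the prolongation\<close>

lemma points_Ga [simp]: "points (Ga j n) = carrier_vec n"
  and gadd_Ga [simp]: "gadd (Ga j n) = (+)"
  and fq_act_Ga [simp]: "fq_act (Ga j n) = (\<lambda>c x. fq_emb j c \<cdot>\<^sub>v x)"
  by (simp_all add: Ga_def)

lemma regular_Ga_ext: "regular (Ga j n) \<subseteq> extensional (carrier_vec n)"
  by (auto simp: Ga_def)

lemma (in base_field) vector_group_Ga: "vector_group j n (Ga j n) (\<lambda>x. x)"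
proof
  have inv: "inv_into (carrier_vec n) (\<lambda>x. x) y = y" if "y \<in> carrier_vec n" for y :: "'k vec"
    using inv_into_f_f[of "\<lambda>x. x" "carrier_vec n" y] that by simp
  have "alg_hom (Ga j n) (Ga j n) (inv_into (carrier_vec n) (\<lambda>x. x))"
  proof -
    have "restrict (f \<circ> inv_into (carrier_vec n) (\<lambda>x. x)) (carrier_vec n) = restrict f (carrier_vec n)"
      for f :: "'k vec \<Rightarrow> 'k"
      by (intro restrict_ext) (simp add: inv)
    thus ?thesis
      using regular_Ga_ext[of j n] by (auto simp: alg_hom_def inv extensional_restrict subset_iff)
  qed
  thus "alg_iso (Ga j n) (Ga j n) (\<lambda>x. x)"
    using alg_hom_id[of "Ga j n"] regular_Ga_ext[of j n]
    by (simp add: alg_iso_def bij_betw_def inj_on_def)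
  show "regular (Ga j n) \<subseteq> extensional (points (Ga j n))"
    using regular_Ga_ext by simp
qed

lemma (in base_field) act_twist:
  "act S (twist CARD('q) b) (\<lambda>x. m x ^ CARD('q)) x = act S b m x ^ CARD('q)" for m :: "'e \<Rightarrow> 'k"
proof -
  have "degree (twist CARD('q) b) \<le> degree b"
    by (rule degree_le) (simp add: twist_def coeff_map_poly coeff_eq_0 finite_UNIV_card_ge_0)
  moreover have "coeff (twist CARD('q) b) i = coeff b i ^ CARD('q)" for i
    by (simp add: twist_def coeff_map_poly finite_UNIV_card_ge_0)
  ultimately show ?thesis
    by (subst act_eq_sum[of _ "degree b"]) (simp_all add: act_def frobenius_sum power_mult_distrib)
qed

context prolongation
begin

sublocale GN: vector_group j N "Ga j N" "\<lambda>x. x"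
  by (rule vector_group_Ga)

lemma alg_hom_unchart_blk:
  assumes "i \<le> k"
  shows "alg_hom (Ga j N) E (\<lambda>x. unchart (blk i x))"
proof (rule alg_hom_by_coordinates[OF GN.vector_group_axioms vector_group_axioms])
  fix r assume r: "r < d"
  have "restrict (\<lambda>x. x $ (i * d + r)) (points (Ga j N)) \<in> hom_Ga j (Ga j N)"
    using block_index_less[OF assms r] by (rule GN.coord_in_hom_Ga)
  also have "restrict (\<lambda>x. x $ (i * d + r)) (points (Ga j N)) =
      restrict (\<lambda>x. \<kappa> (unchart (blk i x)) $ r) (points (Ga j N))"
    using r by (intro restrict_ext) (simp add: vec_block_def)
  finally show "restrict (\<lambda>x. \<kappa> (unchart (blk i x)) $ r) (points (Ga j N)) \<in> hom_Ga j (Ga j N)" .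
qed simp

lemma alg_hom_single_block: "alg_hom E (Ga j N) (\<lambda>x. single_block i (\<kappa> x))"
proof (rule alg_hom_by_coordinates[OF vector_group_axioms GN.vector_group_axioms])
  fix R assume R: "R < N"
  show "restrict (\<lambda>x. single_block i (\<kappa> x) $ R) (points E) \<in> hom_Ga j E"
  proof (cases "R div d = i")
    case True
    have "restrict (\<lambda>x. \<kappa> x $ (R mod d)) (points E) \<in> hom_Ga j E"
      using block_index_cases[OF R] by (intro coord_in_hom_Ga)
    thus ?thesis using True R by (simp add: single_block_def)
  next
    case False
    thus ?thesis using R zero_in_hom_Ga by (simp add: single_block_def)
  qed
qed simp

lemma alg_hom_T: "alg_hom (Ga j N) (Ga j N) T"
proof (rule alg_hom_by_coordinates[OF GN.vector_group_axioms GN.vector_group_axioms])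
  fix R assume R: "R < N"
  define g where "g = restrict (restrict (\<lambda>y. \<kappa> y $ (R mod d)) (points E) \<circ>
      (\<lambda>x. \<Phi> t_var (unchart (blk (R div d) x)))) (points (Ga j N))"
  define h where "h = restrict (\<lambda>x. if R div d = 0 then 0 else x $ (R - d)) (points (Ga j N))"
  have g: "g \<in> hom_Ga j (Ga j N)"
    unfolding g_def using block_index_cases[OF R]
    by (intro GN.compose_in_hom_Ga[OF GN.alg_hom_compose[OF alg_hom_unchart_blk alg_hom_t]] coord_in_hom_Ga)
  have h: "h \<in> hom_Ga j (Ga j N)"
    unfolding h_def using GN.zero_in_hom_Ga GN.coord_in_hom_Ga[of "R - d"] R
    by (cases "R div d = 0") simp_all
  have "restrict (\<lambda>x. g x + restrict (\<lambda>x. -1 * h x) (points (Ga j N)) x) (points (Ga j N)) \<in> hom_Ga j (Ga j N)"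
    by (rule GN.add_in_hom_Ga[OF g GN.scale_in_hom_Ga[OF h]])
  also have "restrict (\<lambda>x. g x + restrict (\<lambda>x. -1 * h x) (points (Ga j N)) x) (points (Ga j N)) =
      restrict (\<lambda>x. T x $ R) (points (Ga j N))"
    using R by (intro restrict_ext) (simp add: g_def h_def T_def)
  finally show "restrict (\<lambda>x. T x $ R) (points (Ga j N)) \<in> hom_Ga j (Ga j N)" .
qed simp

lemma \<delta>_in_hom_Ga:
  assumes "i \<le> k" "m \<in> hom_Ga j E"
  shows "restrict (\<delta> i m) (points (Ga j N)) \<in> hom_Ga j (Ga j N)"
  using GN.compose_in_hom_Ga[OF alg_hom_unchart_blk[OF assms(1)] assms(2)]
  by (simp add: comp_def \<delta>_def[abs_def])

lemma realize_in_hom_Ga: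
  assumes f: "f \<in> free_on k M"
  shows "restrict (realize f) (points (Ga j N)) \<in> hom_Ga j (Ga j N)"
  unfolding realize_def
proof (rule GN.sum_in_hom_Ga)
  fix p assume "p \<in> Poly_Mapping.keys f"
  hence p: "fst p \<le> k" "snd p \<in> hom_Ga j E"
    using f by (auto simp: free_on_def motive_simps)
  have "restrict (act T (Poly_Mapping.lookup f p) (restrict (\<delta> (fst p) (snd p)) (points (Ga j N)))) (points (Ga j N))
      \<in> hom_Ga j (Ga j N)"
    by (rule GN.act_in_hom_Ga[OF alg_hom_T \<delta>_in_hom_Ga[OF p]])
  also have "restrict (act T (Poly_Mapping.lookup f p) (restrict (\<delta> (fst p) (snd p)) (points (Ga j N)))) (points (Ga j N))
      = restrict (act T (Poly_Mapping.lookup f p) (\<delta> (fst p) (snd p))) (points (Ga j N))"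
    by (intro restrict_ext act_cong[of _ "carrier_vec N"]) auto
  finally show "restrict (act T (Poly_Mapping.lookup f p) (\<delta> (fst p) (snd p))) (points (Ga j N)) \<in> hom_Ga j (Ga j N)" .
qed

lemma hom_Ga_block_decomp:
  assumes f: "f \<in> hom_Ga j (Ga j N)" and x: "x \<in> carrier_vec N"
  shows "f x = (\<Sum>i\<le>k. f (single_block i (blk i x)))"
proof -
  define tr where "tr m = vec N (\<lambda>R. if R div d < m then x $ R else 0)" for m
  have add: "f (v + w) = f v + f w" if "v \<in> carrier_vec N" "w \<in> carrier_vec N" for v w
    using GN.hom_Ga_add[OF f] that by simp
  have f0: "f (0\<^sub>v N) = 0"
    using add[of "0\<^sub>v N" "0\<^sub>v N"] by (metis add_0 add_right_cancel left_zero_vec zero_carrier_vec)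
  have "f (tr m) = (\<Sum>i<m. f (single_block i (blk i x)))" for m
  proof (induction m)
    case 0
    have "tr 0 = 0\<^sub>v N" by (auto simp: tr_def)
    thus ?case by (simp add: f0)
  next
    case (Suc m)
    have "tr (Suc m) = tr m + single_block m (blk m x)"
    proof (rule eq_vecI)
      fix R assume "R < dim_vec (tr m + single_block m (blk m x))"
      hence R: "R < N" by (simp add: single_block_def)
      have "R div d * d + R mod d = R" by simp
      thus "tr (Suc m) $ R = (tr m + single_block m (blk m x)) $ R"
        using R block_index_cases[OF R] by (auto simp: tr_def single_block_def vec_block_def less_Suc_eq)
    qed (simp add: tr_def single_block_def)
    thus ?case using Suc by (simp add: add tr_def)
  qed
  moreover have "tr (Suc k) = x"
    using x block_index_cases(1) by (intro eq_vecI) (auto simp: tr_def less_Suc_eq_le)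
  ultimately show ?thesis by (metis lessThan_Suc_atMost)
qed

lemma free_on_add: "f \<in> free_on k M \<Longrightarrow> g \<in> free_on k M \<Longrightarrow> f + g \<in> free_on k M"
  using Poly_Mapping.keys_add[of f g] by (auto simp: free_on_def)

lemma free_on_sum: "(\<And>i. i \<in> I \<Longrightarrow> f i \<in> free_on k M) \<Longrightarrow> (\<Sum>i\<in>I. f i) \<in> free_on k M"
proof (induction I rule: infinite_finite_induct)
  case (insert i I)
  thus ?case by (simp add: free_on_add)
qed (simp_all add: free_on_def)

lemma free_on_diff: "f \<in> free_on k M \<Longrightarrow> g \<in> free_on k M \<Longrightarrow> f - g \<in> free_on k M"
  using keys_diff[of f g] by (auto simp: free_on_def)

lemma free_on_fscale: "f \<in> free_on k M \<Longrightarrow> fscale a f \<in> free_on k M"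
  using keys_fscale_subset[of a f] by (auto simp: free_on_def)

lemma free_on_D: "i \<le> k \<Longrightarrow> m \<in> hom_Ga j E \<Longrightarrow> D i m \<in> free_on k M"
  by (auto simp: free_on_def motive_simps in_keys_iff lookup_D split: if_splits)

text \<open>
  The function \<open>f\<close> is realized by the sum of the symbols \<open>D\<^sub>i m\<^sub>i\<close>, where \<open>m\<^sub>i\<close> is the restriction of \<open>f\<close>
  to block \<open>i\<close>.
\<close>

lemma realize_surj:
  assumes f: "f \<in> hom_Ga j (Ga j N)"
  shows "\<exists>g\<in>free_on k M. \<forall>x\<in>carrier_vec N. realize g x = f x"
proof -
  define \<mu> where "\<mu> i = restrict (f \<circ> (\<lambda>x. single_block i (\<kappa> x))) (points E)" for i
  have \<mu>: "\<mu> i \<in> hom_Ga j E" for i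
    unfolding \<mu>_def by (rule compose_in_hom_Ga[OF alg_hom_single_block f])
  show ?thesis
  proof (intro bexI ballI)
    show "(\<Sum>i\<le>k. D i (\<mu> i)) \<in> free_on k M"
      by (intro free_on_sum free_on_D \<mu>) simp
    show "realize (\<Sum>i\<le>k. D i (\<mu> i)) x = f x" if "x \<in> carrier_vec N" for x
      by (simp add: realize_sum realize_D \<delta>_def \<mu>_def hom_Ga_block_decomp[OF f that])
  qed
qed

lemma realize_free_tau:
  assumes f: "f \<in> free_on k M"
  shows "realize (free_tau CARD('q) M f) x = realize f x ^ CARD('q)"
proof -
  have "\<delta> i (mtau M m) = (\<lambda>x. \<delta> i m x ^ CARD('q))" for i m
    by (simp add: \<delta>_def[abs_def] motive_simps)
  thus ?thesis
    unfolding free_tau_def realize_sum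
    by (simp add: case_prod_beta realize_fscale realize_D act_twist realize_def[of f x] frobenius_sum)
qed

lemma free_on_free_tau:
  assumes "f \<in> free_on k M"
  shows "free_tau CARD('q) M f \<in> free_on k M"
  unfolding free_tau_def case_prod_beta
proof (intro free_on_sum free_on_fscale free_on_D)
  fix p assume "p \<in> Poly_Mapping.keys f"
  thus "fst p \<le> k" "mtau M (snd p) \<in> hom_Ga j E"
    using assms frobenius_in_hom_Ga by (auto simp: free_on_def motive_simps)
qed

text \<open>
  So the quotient that defines the prolongation is the quotient by the fibres of the realization.
\<close>

lemma prolong_equiv_iff:
  "(f, g) \<in> prolong_equiv k M \<longleftrightarrow>
     f \<in> free_on k M \<and> g \<in> free_on k M \<and> (\<forall>x\<in>carrier_vec N. realize f x = realize g x)"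
proof -
  have "f - g \<in> Rel \<longleftrightarrow> (\<forall>x\<in>carrier_vec N. realize f x = realize g x)"
    if "f \<in> free_on k M" "g \<in> free_on k M"
  proof
    assume "f - g \<in> Rel"
    thus "\<forall>x\<in>carrier_vec N. realize f x = realize g x" using realize_relation[of "f - g"] by (simp add: realize_diff)
  next
    assume "\<forall>x\<in>carrier_vec N. realize f x = realize g x"
    thus "f - g \<in> Rel" using that by (intro realize_kernel free_on_diff) (auto simp: realize_diff)
  qed
  thus ?thesis unfolding prolong_equiv_def by blast
qed

definition fibre :: "('k vec \<Rightarrow> 'k) \<Rightarrow> ((nat \<times> ('e \<Rightarrow> 'k)) \<Rightarrow>\<^sub>0 'k poly) set" where
  "fibre f = {g \<in> free_on k M. \<forall>x\<in>carrier_vec N. realize g x = f x}"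

lemma class_eq_fibre:
  assumes "g \<in> free_on k M" "\<And>x. x \<in> carrier_vec N \<Longrightarrow> realize g x = f x"
  shows "prolong_equiv k M `` {g} = fibre f"
  using assms by (auto simp: fibre_def prolong_equiv_iff)

lemma fibre_nonempty: "f \<in> hom_Ga j (Ga j N) \<Longrightarrow> fibre f \<noteq> {}"
  using realize_surj[of f] by (auto simp: fibre_def)

text \<open>
  Realization is surjective, compatible with addition, polynomials and \<open>\<tau>\<close>, and its fibres are the
  classes of the prolongation.
\<close>

theorem motive_iso_prolong:
  assumes \<Psi>: "\<Psi> t_var = T"
  shows "skew_module_iso (motive j (Ga j N) \<Psi>) (prolong CARD('q) k M) fibre"
  unfolding skew_module_iso_def
proof (intro conjI ballI allI)
  show "bij_betw fibre (mcarrier (motive j (Ga j N) \<Psi>)) (mcarrier (prolong CARD('q) k M))"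
    unfolding bij_betw_def
  proof
    show "inj_on fibre (mcarrier (motive j (Ga j N) \<Psi>))"
    proof (rule inj_onI)
      fix f g assume fg: "f \<in> mcarrier (motive j (Ga j N) \<Psi>)" "g \<in> mcarrier (motive j (Ga j N) \<Psi>)" "fibre f = fibre g"
      then obtain h where "h \<in> fibre f" "h \<in> fibre g"
        using fibre_nonempty by (auto simp: motive_simps)
      thus "f = g"
        using fg GN.hom_Ga_eqI[of f g] by (auto simp: fibre_def motive_simps)
    qed
    show "fibre ` mcarrier (motive j (Ga j N) \<Psi>) = mcarrier (prolong CARD('q) k M)"
    proof (intro equalityI subsetI)
      fix X assume "X \<in> fibre ` mcarrier (motive j (Ga j N) \<Psi>)"
      then obtain f where f: "f \<in> hom_Ga j (Ga j N)" "X = fibre f" by (auto simp: motive_simps)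
      obtain g where "g \<in> free_on k M" "\<And>x. x \<in> carrier_vec N \<Longrightarrow> realize g x = f x"
        using realize_surj[OF f(1)] by metis
      with f show "X \<in> mcarrier (prolong CARD('q) k M)"
        by (auto simp: prolong_def Let_def class_eq_fibre[of g f, symmetric] intro: quotientI)
    next
      fix X assume "X \<in> mcarrier (prolong CARD('q) k M)"
      then obtain g where g: "g \<in> free_on k M" "X = prolong_equiv k M `` {g}"
        by (auto simp: prolong_def Let_def elim: quotientE)
      hence "X = fibre (restrict (realize g) (points (Ga j N)))"
        using class_eq_fibre[of g "restrict (realize g) (points (Ga j N))"] by simp
      thus "X \<in> fibre ` mcarrier (motive j (Ga j N) \<Psi>)"
        using realize_in_hom_Ga[OF g(1)] unfolding motive_simps by blast
    qed
  qed
next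
  fix f g assume "f \<in> mcarrier (motive j (Ga j N) \<Psi>)" "g \<in> mcarrier (motive j (Ga j N) \<Psi>)"
  hence ne: "fibre f \<noteq> {}" "fibre g \<noteq> {}" by (simp_all add: fibre_nonempty motive_simps)
  have "prolong_equiv k M `` {f' + g'} = fibre (madd (motive j (Ga j N) \<Psi>) f g)"
    if "f' \<in> fibre f" "g' \<in> fibre g" for f' g'
    using that by (intro class_eq_fibre) (auto simp: fibre_def free_on_add realize_add motive_simps)
  thus "fibre (madd (motive j (Ga j N) \<Psi>) f g) = madd (prolong CARD('q) k M) (fibre f) (fibre g)"
    using ne by (simp add: prolong_def Let_def)
next
  fix a f assume "f \<in> mcarrier (motive j (Ga j N) \<Psi>)"
  hence ne: "fibre f \<noteq> {}" by (simp add: fibre_nonempty motive_simps)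
  have "prolong_equiv k M `` {fscale a f'} = fibre (mscale (motive j (Ga j N) \<Psi>) a f)"
    if "f' \<in> fibre f" for f'
    using that by (intro class_eq_fibre)
      (auto simp: fibre_def free_on_fscale realize_fscale motive_simps \<Psi> intro!: act_cong[of _ "carrier_vec N"])
  thus "fibre (mscale (motive j (Ga j N) \<Psi>) a f) = mscale (prolong CARD('q) k M) a (fibre f)"
    using ne by (simp add: prolong_def Let_def)
next
  fix f assume "f \<in> mcarrier (motive j (Ga j N) \<Psi>)"
  hence ne: "fibre f \<noteq> {}" by (simp add: fibre_nonempty motive_simps)
  have "prolong_equiv k M `` {free_tau CARD('q) M f'} = fibre (mtau (motive j (Ga j N) \<Psi>) f)"
    if "f' \<in> fibre f" for f'
    using that by (intro class_eq_fibre) (auto simp: fibre_def free_on_free_tau realize_free_tau motive_simps)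
  thus "fibre (mtau (motive j (Ga j N) \<Psi>) f) = mtau (prolong CARD('q) k M) (fibre f)"
    using ne by (simp add: prolong_def Let_def)
qed

end

section \<open>Block matrices\<close>

lemma vec_eq_if_blocks_eq:
  assumes "x \<in> carrier_vec (n * d)" "y \<in> carrier_vec (n * d)"
    and "\<And>I. I < n \<Longrightarrow> vec_block d I x = vec_block d I y"
  shows "x = y"
proof (rule eq_vecI)
  fix R assume "R < dim_vec y"
  hence R: "R < n * d" using assms by simp
  hence "d > 0" by (auto intro: Nat.gr0I)
  have "R div d < n" using R by (simp add: less_mult_imp_div_less)
  from assms(3)[OF this] have "vec_block d (R div d) x $ (R mod d) = vec_block d (R div d) y $ (R mod d)"
    by simp
  thus "x $ R = y $ R" using \<open>d > 0\<close> by (simp add: vec_block_def)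
qed (use assms in simp)

lemma block_mat_carrier [simp]: "block_mat n d B \<in> carrier_mat (n * d) (n * d)"
  by (simp add: block_mat_def)

lemma vec_block_mult:
  assumes "x \<in> carrier_vec (n * d)" and B: "\<And>I J. B I J \<in> carrier_mat d d" and "I < n" "r < d"
  shows "vec_block d I (block_mat n d B *\<^sub>v x) $ r = (\<Sum>J<n. (B I J *\<^sub>v vec_block d J x) $ r)"
proof -
  define f where "f C = B I (C div d) $$ (r, C mod d) * x $ C" for C
  have "vec_block d I (block_mat n d B *\<^sub>v x) $ r = (\<Sum>C<n * d. f C)"
    using assms block_bound[of I n r d]
    by (simp add: vec_block_def block_mat_def scalar_prod_def f_def lessThan_atLeast0)
  also have "\<dots> = (\<Sum>J<n. \<Sum>C\<in>{J * d..<J * d + d}. f C)"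
    by (rule sum.nat_group[symmetric])
  also have "\<dots> = (\<Sum>J<n. (B I J *\<^sub>v vec_block d J x) $ r)"
  proof (rule sum.cong)
    fix J assume "J \<in> {..<n}"
    have "(\<Sum>C\<in>{J * d..<J * d + d}. f C) = (\<Sum>c\<in>{0..<d}. f (J * d + c))"
      by (rule sum.reindex_bij_witness[of _ "\<lambda>c. J * d + c" "\<lambda>C. C - J * d"]) auto
    also have "\<dots> = (\<Sum>c\<in>{0..<d}. B I J $$ (r, c) * vec_block d J x $ c)"
      by (intro sum.cong) (auto simp: f_def vec_block_def)
    also have "\<dots> = (B I J *\<^sub>v vec_block d J x) $ r"
      using B[of I J] \<open>r < d\<close> by (auto simp: scalar_prod_def vec_block_def)
    finally show "(\<Sum>C\<in>{J * d..<J * d + d}. f C) = (B I J *\<^sub>v vec_block d J x) $ r" .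
  qed simp
  finally show ?thesis .
qed

lemma diag_block_mat_replicate:
  assumes A: "A \<in> carrier_mat d d"
  shows "diag_block_mat (replicate n A) = block_mat n d (\<lambda>I J. if I = J then A else 0\<^sub>m d d)"
proof (induction n)
  case 0
  show ?case by (rule eq_matI) (simp_all add: block_mat_def)
next
  case (Suc n)
  show ?case
  proof (rule eq_matI)
    fix r c
    assume "r < dim_row (block_mat (Suc n) d (\<lambda>I J. if I = J then A else 0\<^sub>m d d))"
      and "c < dim_col (block_mat (Suc n) d (\<lambda>I J. if I = J then A else 0\<^sub>m d d))"
    hence rc: "r < d + n * d" "c < d + n * d" by (simp_all add: block_mat_def)
    hence "d > 0" by (auto intro: Nat.gr0I)
    have lt: "x < d \<Longrightarrow> x div d = 0 \<and> x mod d = x" for x by simp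
    have ge: "x div d = Suc ((x - d) div d) \<and> x mod d = (x - d) mod d" if "\<not> x < d" for x
      using that \<open>d > 0\<close> by (simp add: le_div_geq le_mod_geq)
    have "x mod d < d" for x using \<open>d > 0\<close> by simp
    thus "diag_block_mat (replicate (Suc n) A) $$ (r, c) =
        block_mat (Suc n) d (\<lambda>I J. if I = J then A else 0\<^sub>m d d) $$ (r, c)"
      using rc A Suc.IH lt[of r] lt[of c] ge[of r] ge[of c]
      by (cases "r < d"; cases "c < d") (auto simp: block_mat_def Let_def)
  qed (use A Suc.IH in \<open>auto simp: block_mat_def Let_def\<close>)
qed

text \<open>
  One formula serves all coefficients of the prolonged matrix: \<open>b\<close> tells whether the
  subdiagonal blocks \<open>-1\<close> of the constant term are present.
\<close>

definition prolong_block :: "nat \<Rightarrow> 'k::field mat \<Rightarrow> bool \<Rightarrow> nat \<Rightarrow> nat \<Rightarrow> 'k mat" where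
  "prolong_block d A b I J = (if I = J then A else if b \<and> I = J + 1 then - 1\<^sub>m d else 0\<^sub>m d d)"

lemma prolong_coeff_block:
  assumes "A i \<in> carrier_mat d d"
  shows "prolong_coeff k d A i = block_mat (k + 1) d (prolong_block d (A i) (i = 0))"
proof (cases "i = 0")
  case True
  thus ?thesis by (simp add: prolong_coeff_def prolong_block_def[abs_def] cong: if_cong)
next
  case False
  thus ?thesis 
    unfolding prolong_coeff_def prolong_block_def[abs_def] diag_block_mat_replicate[OF assms]
    by (simp cong: if_cong)
qed

lemma vec_block_prolong_block:
  assumes x: "x \<in> carrier_vec (n * d)" and A: "A \<in> carrier_mat d d" and I: "I < n" and r: "r < d"
  shows "vec_block d I (block_mat n d (prolong_block d A b) *\<^sub>v x) $ r =
     (A *\<^sub>v vec_block d I x) $ r - (if b \<and> I > 0 then vec_block d (I - 1) x $ r else 0)"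
proof -
  have "vec_block d I (block_mat n d (prolong_block d A b) *\<^sub>v x) $ r =
      (\<Sum>J<n. (prolong_block d A b I J *\<^sub>v vec_block d J x) $ r)"
    using A by (intro vec_block_mult x I r) (simp add: prolong_block_def)
  \<comment> \<open>For \<open>I = 0\<close> the index \<open>I - 1\<close> is \<open>0\<close>, and the guard \<open>I > 0\<close> removes the term.\<close>
  also have "\<dots> = (\<Sum>J<n. (if J = I then (A *\<^sub>v vec_block d I x) $ r else 0) +
      (if J = I - 1 then (if b \<and> I > 0 then - vec_block d (I - 1) x $ r else 0) else 0))"
  proof (rule sum.cong)
    fix J assume "J \<in> {..<n}"
    show "(prolong_block d A b I J *\<^sub>v vec_block d J x) $ r =
       (if J = I then (A *\<^sub>v vec_block d I x) $ r else 0) +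
       (if J = I - 1 then (if b \<and> I > 0 then - vec_block d (I - 1) x $ r else 0) else 0)"
      using r by (auto simp: prolong_block_def scalar_prod_def vec_block_def sum_negf
          if_distrib[of "\<lambda>t. t * _"] if_distrib[of uminus] cong: if_cong)
  qed simp
  also have "\<dots> = (A *\<^sub>v vec_block d I x) $ r - (if b \<and> I > 0 then vec_block d (I - 1) x $ r else 0)"
    using I by (simp add: sum.distrib less_imp_diff_less)
  finally show ?thesis .
qed

lemma pow_mat_mult_vec:
  assumes V: "V \<in> carrier_mat n n" and x: "x \<in> carrier_vec n"
  shows "(V ^\<^sub>m a) *\<^sub>v x = ((\<lambda>x. V *\<^sub>v x) ^^ a) x"
  using x
proof (induction a arbitrary: x)
  case 0
  thus ?case using V by simp
next
  case (Suc a)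
  have "(V ^\<^sub>m Suc a) *\<^sub>v x = (V ^\<^sub>m a) *\<^sub>v (V *\<^sub>v x)"
    using V Suc.prems by (simp add: assoc_mult_mat_vec[of _ n n _ n])
  also have "\<dots> = ((\<lambda>x. V *\<^sub>v x) ^^ a) (V *\<^sub>v x)"
    using V Suc.prems by (intro Suc.IH) auto
  finally show ?case by (simp add: funpow_swap1)
qed

lemma prolong_block_minus_scalar:
  assumes A: "A \<in> carrier_mat d d"
  shows "block_mat n d (prolong_block d A b) - c \<cdot>\<^sub>m 1\<^sub>m (n * d) =
     block_mat n d (prolong_block d (A - c \<cdot>\<^sub>m 1\<^sub>m d) b)"
proof (rule eq_matI)
  fix r s assume "r < dim_row (block_mat n d (prolong_block d (A - c \<cdot>\<^sub>m 1\<^sub>m d) b))"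
    "s < dim_col (block_mat n d (prolong_block d (A - c \<cdot>\<^sub>m 1\<^sub>m d) b))"
  hence rs: "r < n * d" "s < n * d" by (simp_all add: block_mat_def)
  hence d: "d > 0" by (auto intro: Nat.gr0I)
  have "r = s \<longleftrightarrow> r div d = s div d \<and> r mod d = s mod d"
    by (metis div_mult_mod_eq)
  thus "(block_mat n d (prolong_block d A b) - c \<cdot>\<^sub>m 1\<^sub>m (n * d)) $$ (r, s) =
     block_mat n d (prolong_block d (A - c \<cdot>\<^sub>m 1\<^sub>m d) b) $$ (r, s)"
    using rs d A by (auto simp: block_mat_def prolong_block_def)
qed (simp_all add: block_mat_def)

text \<open>
  On a vector whose first \<open>I\<close> blocks are zero, the matrix keeps these blocks zero and acts on block
  \<open>I\<close> as \<open>A\<close>. So every \<open>p\<close> steps make one more block vanish, whatever the vector was.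
\<close>

lemma nilpotent_prolong_block:
  assumes A: "A \<in> carrier_mat d d" and nil: "A ^\<^sub>m p = 0\<^sub>m d d"
  shows "block_mat n d (prolong_block d A b) ^\<^sub>m (p * n) = 0\<^sub>m (n * d) (n * d)"
proof -
  define V where "V = block_mat n d (prolong_block d A b)"
  have V: "V \<in> carrier_mat (n * d) (n * d)" by (simp add: V_def)
  define F where "F = (\<lambda>x. V *\<^sub>v x)"
  have F_in: "F x \<in> carrier_vec (n * d)" if "x \<in> carrier_vec (n * d)" for x
    unfolding F_def using V that by simp
  have Fp_in: "(F ^^ a) x \<in> carrier_vec (n * d)" if "x \<in> carrier_vec (n * d)" for x a
    by (induction a) (simp_all add: that F_in)
  have block: "vec_block d J (F w) $ r = (A *\<^sub>v vec_block d J w) $ r - (if b \<and> J > 0 then vec_block d (J - 1) w $ r else 0)"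
    if "w \<in> carrier_vec (n * d)" "J < n" "r < d" for w J r
    unfolding F_def V_def using vec_block_prolong_block[OF that(1) A that(2,3)] .
  have step: "(\<forall>J<I. vec_block d J (F w) = 0\<^sub>v d) \<and> vec_block d I (F w) = A *\<^sub>v vec_block d I w"
    if w: "w \<in> carrier_vec (n * d)" "\<forall>J<I. vec_block d J w = 0\<^sub>v d" "I < n" for I w
  proof (intro conjI allI impI)
    show "vec_block d J (F w) = 0\<^sub>v d" if "J < I" for J
      using that w A by (intro eq_vecI) (auto simp: block)
    show "vec_block d I (F w) = A *\<^sub>v vec_block d I w"
      using w A by (intro eq_vecI) (auto simp: block)
  qed
  have steps: "(\<forall>J<I. vec_block d J ((F ^^ a) w) = 0\<^sub>v d) \<and>
      vec_block d I ((F ^^ a) w) = (A ^\<^sub>m a) *\<^sub>v vec_block d I w"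
    if "w \<in> carrier_vec (n * d)" "\<forall>J<I. vec_block d J w = 0\<^sub>v d" "I < n" for I a w
    using that
  proof (induction a arbitrary: w)
    case 0
    thus ?case using A by simp
  next
    case (Suc a)
    have "(A ^\<^sub>m a) *\<^sub>v (A *\<^sub>v vec_block d I w) = (A ^\<^sub>m Suc a) *\<^sub>v vec_block d I w"
      using A by (simp add: assoc_mult_mat_vec[of _ d d _ d])
    thus ?case
      using Suc.IH[of "F w"] step[OF Suc.prems] Suc.prems by (simp add: F_in funpow_swap1)
  qed
  have vanish: "\<forall>J<I. vec_block d J ((F ^^ (p * I)) x) = 0\<^sub>v d"
    if "x \<in> carrier_vec (n * d)" "I \<le> n" for x I
    using that(2)
  proof (induction I)
    case (Suc I)
    define w where "w = (F ^^ (p * I)) x"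
    have w: "w \<in> carrier_vec (n * d)" "\<forall>J<I. vec_block d J w = 0\<^sub>v d"
      using Suc Fp_in[OF that(1)] by (auto simp: w_def)
    have "(F ^^ (p * Suc I)) x = (F ^^ p) w" by (simp add: w_def funpow_add)
    moreover have "0\<^sub>m d d *\<^sub>v vec_block d I w = 0\<^sub>v d" by (intro eq_vecI) (simp_all add: scalar_prod_def)
    ultimately show ?case
      using steps[OF w, of p] Suc.prems by (auto simp: nil less_Suc_eq)
  qed simp
  have "V ^\<^sub>m (p * n) *\<^sub>v x = 0\<^sub>v (n * d)" if "x \<in> carrier_vec (n * d)" for x
  proof (rule vec_eq_if_blocks_eq[of _ n d])
    show "V ^\<^sub>m (p * n) *\<^sub>v x \<in> carrier_vec (n * d)"
      using V that by (simp add: pow_mat_mult_vec[OF V that] Fp_in[OF that, unfolded F_def])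
    fix I assume "I < n"
    thus "vec_block d I (V ^\<^sub>m (p * n) *\<^sub>v x) = vec_block d I (0\<^sub>v (n * d))"
      using vanish[OF that, of n] block_bound[of I n]
      by (auto simp: pow_mat_mult_vec[OF V that] F_def[symmetric] vec_block_def intro!: eq_vecI)
  qed simp
  moreover define Z where "Z = V ^\<^sub>m (p * n)"
  ultimately have zero: "Z *\<^sub>v x = 0\<^sub>v (n * d)" if "x \<in> carrier_vec (n * d)" for x
    using that by simp
  have Z: "Z \<in> carrier_mat (n * d) (n * d)" using V by (simp add: Z_def)
  have "Z = 0\<^sub>m (n * d) (n * d)"
  proof (rule eq_matI)
    fix r c assume "r < dim_row (0\<^sub>m (n * d) (n * d) :: 'a mat)" "c < dim_col (0\<^sub>m (n * d) (n * d) :: 'a mat)"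
    hence rc: "r < n * d" "c < n * d" by simp_all
    have "col Z c = col (Z * 1\<^sub>m (n * d)) c"
      by (simp only: right_mult_one_mat[OF Z])
    also have "\<dots> = Z *\<^sub>v col (1\<^sub>m (n * d)) c"
      using rc Z by (intro col_mult2) auto
    also have "\<dots> = 0\<^sub>v (n * d)" using rc by (intro zero) simp
    finally have "col Z c $ r = 0" using rc by simp
    thus "Z $$ (r, c) = 0\<^sub>m (n * d) (n * d) $$ (r, c)"
      using rc Z by simp
  qed (use Z in simp_all)
  thus ?thesis by (simp add: Z_def V_def)
qed

section \<open>The matrix of the prolongation\<close>

context prolongation
begin

text \<open>
  Both sides are compared block by block. The subdiagonal blocks occur only in the coefficient of
  \<open>\<tau>^0\<close>, and there they contribute \<open>- x\<^sub>I\<^sub>-\<^sub>1\<close> to block \<open>I\<close>, as in the definition of \<open>T\<close>.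
\<close>

lemma T_eq_skew_mat_apply:
  assumes A: "has_skew_matrix E d \<kappa> (\<Phi> t_var) s A" and x: "x \<in> carrier_vec N"
  shows "T x = skew_mat_apply CARD('q) N s (prolong_coeff k d A) x"
proof (rule vec_eq_if_blocks_eq[of _ "k + 1" d])
  have N: "N = (k + 1) * d" by (simp add: N_def mult.commute)
  have Ai: "A i \<in> carrier_mat d d" if "i \<le> s" for i
    using A that by (simp add: has_skew_matrix_def)
  show "T x \<in> carrier_vec ((k + 1) * d)" "skew_mat_apply CARD('q) N s (prolong_coeff k d A) x \<in> carrier_vec ((k + 1) * d)"
    by (simp_all only: T_in N[symmetric]) (simp add: skew_mat_apply_def)
  fix I assume I: "I < k + 1"
  show "vec_block d I (T x) = vec_block d I (skew_mat_apply CARD('q) N s (prolong_coeff k d A) x)"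
  proof (rule eq_vecI)
    fix r assume "r < dim_vec (vec_block d I (skew_mat_apply CARD('q) N s (prolong_coeff k d A) x))"
    hence r: "r < d" by (simp add: vec_block_def)
    define y where "y i = map_vec (\<lambda>c. c ^ (CARD('q) ^ i)) x" for i
    define z where "z = (if I > 0 then vec_block d (I - 1) x $ r else 0)"
    have IN: "I * d + r < N" using block_bound[OF I r] by (simp add: N)
    have JN: "J * d + r' < N" if "J \<le> I" "r' < d" for J r'
      using block_bound[of J "k + 1" r' d] that I by (simp add: N)
    have y: "y i \<in> carrier_vec ((k + 1) * d)" for i using x by (simp add: y_def N)
    have "vec_block d I (skew_mat_apply CARD('q) N s (prolong_coeff k d A) x) $ r =
        (\<Sum>i\<le>s. vec_block d I (prolong_coeff k d A i *\<^sub>v y i) $ r)"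
      using r IN by (simp add: vec_block_def skew_mat_apply_def y_def)
    also have "\<dots> = (\<Sum>i\<le>s. (A i *\<^sub>v vec_block d I (y i)) $ r - (if i = 0 then z else 0))"
    proof (rule sum.cong)
      fix i assume "i \<in> {..s}"
      hence i: "i \<le> s" by simp
      have "vec_block d (I - 1) (y 0) $ r = vec_block d (I - 1) x $ r"
        using r x JN[of "I - 1" r] by (simp add: y_def vec_block_def)
      thus "vec_block d I (prolong_coeff k d A i *\<^sub>v y i) $ r =
          (A i *\<^sub>v vec_block d I (y i)) $ r - (if i = 0 then z else 0)"
        unfolding prolong_coeff_block[of A i, OF Ai[OF i]] vec_block_prolong_block[OF y Ai[OF i] I r]
        by (auto simp: z_def)
    qed simp
    also have "\<dots> = (\<Sum>i\<le>s. (A i *\<^sub>v vec_block d I (y i)) $ r) - z"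
      by (simp add: sum_subtractf)
    also have "(\<Sum>i\<le>s. (A i *\<^sub>v vec_block d I (y i)) $ r) =
        skew_mat_apply CARD('q) d s A (blk I x) $ r"
    proof -
      have "vec_block d I (y i) = map_vec (\<lambda>c. c ^ (CARD('q) ^ i)) (blk I x)" for i
        using x JN[of I] by (intro eq_vecI) (auto simp: y_def vec_block_def)
      thus ?thesis using r by (simp add: skew_mat_apply_def)
    qed
    also have "\<dots> = \<kappa> (\<Phi> t_var (unchart (blk I x))) $ r"
      using A by (simp add: has_skew_matrix_def)
    also have "\<kappa> (\<Phi> t_var (unchart (blk I x))) $ r - z = vec_block d I (T x) $ r"
      using r I by (simp add: blk_T z_def)
    finally show "vec_block d I (T x) $ r =
      vec_block d I (skew_mat_apply CARD('q) N s (prolong_coeff k d A) x) $ r" by simp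
  qed (simp add: vec_block_def)
qed

lemma prolong_coeff_carrier:
  assumes "A i \<in> carrier_mat d d"
  shows "prolong_coeff k d A i \<in> carrier_mat N N"
  using block_mat_carrier[of "k + 1" d "prolong_block d (A i) (i = 0)"]
  by (simp add: prolong_coeff_block[of A i, OF assms] N_def mult.commute)

lemma nilpotent_prolong_coeff:
  assumes A: "A 0 \<in> carrier_mat d d" and nil: "(A 0 - c \<cdot>\<^sub>m 1\<^sub>m d) ^\<^sub>m p = 0\<^sub>m d d"
  shows "\<exists>n. (prolong_coeff k d A 0 - c \<cdot>\<^sub>m 1\<^sub>m N) ^\<^sub>m n = 0\<^sub>m N N"
proof -
  have N: "N = (k + 1) * d" by (simp add: N_def mult.commute)
  have "A 0 - c \<cdot>\<^sub>m 1\<^sub>m d \<in> carrier_mat d d" by (intro minus_carrier_mat) simp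
  from nilpotent_prolong_block[OF this nil, of "k + 1" True]
  show ?thesis
    unfolding N prolong_coeff_block[of A 0, OF A] prolong_block_minus_scalar[OF A] by auto
qed

section \<open>The prolongation as a t-module\<close>

text \<open>\<open>F\<^sub>q[t]\<close> as a subring of \<open>K[t]\<close>.\<close>

definition scalars :: "'q poly \<Rightarrow> 'k poly" where "scalars = map_poly (fq_emb j)"

lemma coeff_scalars: "coeff (scalars f) n = fq_emb j (coeff f n)"
  by (simp add: scalars_def coeff_map_poly)

lemma scalars_simps [simp]:
  "scalars 0 = 0" "scalars 1 = 1" "scalars (pCons c f) = pCons (fq_emb j c) (scalars f)"
  "scalars (smult c f) = smult (fq_emb j c) (scalars f)" "scalars (f + g) = scalars f + scalars g"
  by (rule poly_eqI, simp add: coeff_scalars coeff_pCons fq_emb_mult fq_emb_add split: nat.split)+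

lemma scalars_mult: "scalars (f * g) = scalars f * scalars g"
  by (induction f) simp_all

text \<open>
  A polynomial \<open>f\<close> in \<open>F\<^sub>q[t]\<close> acts through \<open>T\<close>. Coordinate by coordinate this is the action of \<open>f\<close>
  on the coordinate functions, so the laws of \<open>act\<close> carry over.
\<close>

definition \<Psi> :: "'q poly \<Rightarrow> 'k vec \<Rightarrow> 'k vec" where
  "\<Psi> f x = vec N (\<lambda>r. act T (scalars f) (\<lambda>y. y $ r) x)"

lemma \<Psi>_in [simp]: "\<Psi> f x \<in> carrier_vec N"
  by (simp add: \<Psi>_def)

lemma \<Psi>_t: "\<Psi> t_var = T"
proof
  show "\<Psi> t_var x = T x" for x
    by (rule eq_vecI) (simp_all add: \<Psi>_def T_def)
qed

lemma coordinate_act_in_hom_Ga: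
  assumes "r < N"
  shows "restrict (act T a (\<lambda>y. y $ r)) (carrier_vec N) \<in> hom_Ga j (Ga j N)"
proof -
  have "restrict (act T a (restrict (\<lambda>y. y $ r) (points (Ga j N)))) (points (Ga j N)) \<in> hom_Ga j (Ga j N)"
    by (rule GN.act_in_hom_Ga[OF alg_hom_T GN.coord_in_hom_Ga[OF assms]])
  also have "restrict (act T a (restrict (\<lambda>y. y $ r) (points (Ga j N)))) (points (Ga j N))
      = restrict (act T a (\<lambda>y. y $ r)) (carrier_vec N)"
    unfolding points_Ga by (intro restrict_ext act_cong[of _ "carrier_vec N"]) auto
  finally show ?thesis .
qed

text \<open>
  An \<open>F\<^sub>q\<close>-linear function commutes with \<open>F\<^sub>q\<close>-linear combinations of powers of \<open>T\<close>. Applied to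
  coordinates, this makes \<open>\<Psi>\<close> multiplicative.
\<close>

lemma hom_Ga_\<Psi>:
  assumes u: "u \<in> hom_Ga j (Ga j N)" and x: "x \<in> carrier_vec N"
  shows "u (\<Psi> f x) = act T (scalars f) u x"
  using x
proof (induction f arbitrary: x)
  case 0
  have "\<Psi> 0 x = fq_emb j 0 \<cdot>\<^sub>v x"
    using 0 by (intro eq_vecI) (auto simp: \<Psi>_def)
  thus ?case using GN.hom_Ga_act[OF u, of x 0] 0 by simp
next
  case (pCons c f)
  have "\<Psi> (pCons c f) x = fq_emb j c \<cdot>\<^sub>v x + \<Psi> f (T x)"
    using pCons.prems by (intro eq_vecI) (auto simp: \<Psi>_def act_pCons)
  hence "u (\<Psi> (pCons c f) x) = fq_emb j c * u x + u (\<Psi> f (T x))"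
    using pCons.prems GN.hom_Ga_add[OF u, of "fq_emb j c \<cdot>\<^sub>v x" "\<Psi> f (T x)"] GN.hom_Ga_act[OF u, of x c]
    by simp
  thus ?case using pCons.IH[of "T x"] by (simp add: act_pCons)
qed

lemma t_module_prolongation:
  assumes A: "has_skew_matrix E d \<kappa> (\<Phi> t_var) s A"
    and nil: "(A 0 - theta j \<cdot>\<^sub>m 1\<^sub>m d) ^\<^sub>m p = 0\<^sub>m d d"
  shows "t_module j N (Ga j N) \<Psi>"
  unfolding t_module_def
proof (intro conjI allI ballI)
  show "regular (Ga j N) \<subseteq> extensional (points (Ga j N))" by (rule GN.ext)
next
  fix f
  show "alg_hom (Ga j N) (Ga j N) (\<Psi> f)"
  proof (rule alg_hom_by_coordinates[OF GN.vector_group_axioms GN.vector_group_axioms])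
    fix r assume r: "r < N"
    show "restrict (\<lambda>x. \<Psi> f x $ r) (points (Ga j N)) \<in> hom_Ga j (Ga j N)"
      using coordinate_act_in_hom_Ga[OF r, of "scalars f"] r by (simp add: \<Psi>_def)
  qed simp
next
  fix x assume "x \<in> points (Ga j N)"
  hence x: "x \<in> carrier_vec N" by simp
  show "\<Psi> 1 x = x" using x by (intro eq_vecI) (auto simp: \<Psi>_def)
  fix f g c
  show "\<Psi> (f + g) x = gadd (Ga j N) (\<Psi> f x) (\<Psi> g x)"
    by (intro eq_vecI) (auto simp: \<Psi>_def act_add_left)
  show "\<Psi> (smult c f) x = fq_act (Ga j N) c (\<Psi> f x)"
    by (intro eq_vecI) (auto simp: \<Psi>_def act_smult)
  show "\<Psi> (f * g) x = \<Psi> f (\<Psi> g x)"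
  proof (rule eq_vecI)
    fix r assume "r < dim_vec (\<Psi> f (\<Psi> g x))"
    hence r: "r < N" by (simp add: \<Psi>_def)
    define u where "u = restrict (act T (scalars f) (\<lambda>y. y $ r)) (carrier_vec N)"
    \<comment> \<open>Polynomials act on functions by precomposition, which reverses the order of the factors.\<close>
    have "\<Psi> (f * g) x $ r = act T (scalars g) (act T (scalars f) (\<lambda>y. y $ r)) x"
      using r by (simp add: \<Psi>_def mult.commute[of f] scalars_mult act_mult)
    also have "\<dots> = act T (scalars g) u x"
      using x by (intro act_cong[of _ "carrier_vec N"]) (auto simp: u_def)
    also have "\<dots> = u (\<Psi> g x)"
      unfolding u_def by (rule hom_Ga_\<Psi>[OF coordinate_act_in_hom_Ga[OF r] x, symmetric])
    also have "\<dots> = \<Psi> f (\<Psi> g x) $ r"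
      using r by (simp add: u_def) (simp add: \<Psi>_def)
    finally show "\<Psi> (f * g) x $ r = \<Psi> f (\<Psi> g x) $ r" .
  qed (simp add: \<Psi>_def)
next
  have Ai: "A i \<in> carrier_mat d d" if "i \<le> s" for i
    using A that by (simp add: has_skew_matrix_def)
  have "has_skew_matrix (Ga j N) N (\<lambda>x. x) (\<Psi> t_var) s (prolong_coeff k d A)"
    by (simp add: has_skew_matrix_def prolong_coeff_carrier Ai \<Psi>_t T_eq_skew_mat_apply[OF A])
  thus "\<exists>\<kappa> s A. alg_iso (Ga j N) (Ga j N) \<kappa> \<and> has_skew_matrix (Ga j N) N \<kappa> (\<Psi> t_var) s A \<and>
      (\<exists>n. (A 0 - theta j \<cdot>\<^sub>m 1\<^sub>m N) ^\<^sub>m n = 0\<^sub>m N N)"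
    using GN.iso nilpotent_prolong_coeff[of A, OF Ai nil] by blast
qed

text \<open>
  The motives of any prolongation \<open>F\<close> and of the block group are both isomorphic to the prolonged
  motive, hence to each other, and the resulting isomorphism of groups is the required coordinate
  system.
\<close>

lemma prolongation_coordinates:
  fixes F :: "('q, 'k, 'f) alg_group"
  assumes A: "has_skew_matrix E d \<kappa> (\<Phi> t_var) s A"
    and F: "is_prolongation j k E \<Phi> n F \<Theta>"
  shows "n = N \<and> (\<exists>\<kappa>'. alg_iso F (Ga j N) \<kappa>' \<and>
          has_skew_matrix F N \<kappa>' (\<Theta> t_var) s (prolong_coeff k d A))"
proof -
  from F obtain \<mu> h where \<mu>: "alg_iso F (Ga j n) \<mu>" "regular F \<subseteq> extensional (points F)"
    and t: "alg_hom F F (\<Theta> t_var)"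
    and h: "skew_module_iso (motive j F \<Theta>) (prolong CARD('q) k M) h"
    unfolding is_prolongation_def t_module_def by blast
  interpret F: vector_group j n F \<mu>
    by unfold_locales (rule \<mu>)+
  have "skew_module_iso (motive j (Ga j N) \<Psi>) (motive j F \<Theta>)
      (\<lambda>x. inv_into (mcarrier (motive j F \<Theta>)) h (fibre x))"
    by (rule skew_module_iso_trans_inv[OF motive_iso_prolong[of \<Psi>, OF \<Psi>_t] h F.closed_motive[of \<Theta>, OF t]])
  hence "N = n \<and> (\<exists>\<phi>. alg_iso F (Ga j N) \<phi> \<and> (\<forall>x\<in>points F. \<phi> (\<Theta> t_var x) = \<Psi> t_var (\<phi> x)))"
    using alg_hom_T t
    by (intro motive_iso_realized[OF F.vector_group_axioms GN.vector_group_axioms]) (simp_all add: \<Psi>_t)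
  then obtain \<phi> where "N = n" and "alg_iso F (Ga j N) \<phi>"
    and \<phi>: "\<forall>x\<in>points F. \<phi> (\<Theta> t_var x) = T (\<phi> x)"
    unfolding \<Psi>_t by blast
  moreover have "\<phi> x \<in> carrier_vec N" if "x \<in> points F" for x
    using \<open>alg_iso F (Ga j N) \<phi>\<close> that by (auto simp: alg_iso_def alg_hom_def)
  moreover have "A i \<in> carrier_mat d d" if "i \<le> s" for i
    using A that by (simp add: has_skew_matrix_def)
  ultimately show ?thesis
    by (auto simp: has_skew_matrix_def prolong_coeff_carrier T_eq_skew_mat_apply[OF A])
qed

end

theorem theorem5p2:
  fixes j :: "'q::{finite,field} poly fract \<Rightarrow> 'k::field"
    and E :: "('q, 'k, 'e) alg_group"
    and \<Phi> :: "'q poly \<Rightarrow> 'e \<Rightarrow> 'e"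
    and \<kappa> :: "'e \<Rightarrow> 'k vec"
    and A :: "nat \<Rightarrow> 'k mat"
    and d s k :: nat
  assumes "finite_extension j"
    and "t_module j d E \<Phi>"
    and "alg_iso E (Ga j d) \<kappa>"
    and "has_skew_matrix E d \<kappa> (\<Phi> t_var) s A"
  shows "(\<exists>n (F :: ('q, 'k, 'k vec) alg_group) \<Psi>. is_prolongation j k E \<Phi> n F \<Psi>) \<and>
    (\<forall>n (F :: ('q, 'k, 'f) alg_group) \<Psi>. is_prolongation j k E \<Phi> n F \<Psi> \<longrightarrow>
       n = d * (k + 1) \<and>
       (\<exists>\<kappa>'. alg_iso F (Ga j (d * (k + 1))) \<kappa>' \<and>
          has_skew_matrix F (d * (k + 1)) \<kappa>' (\<Psi> t_var) s (prolong_coeff k d A)))"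
proof -
  have j: "field_hom j" using assms(1) by (simp add: finite_extension_def)
  have prolongation: "prolongation j d E \<mu> \<Phi>" if "alg_iso E (Ga j d) \<mu>" for \<mu>
    using assms(2) j that
    by (intro prolongation.intro prolongation_axioms.intro vector_group.intro vector_group_axioms.intro
        base_field.intro) (auto simp: t_module_def)
  show ?thesis
  proof (intro conjI allI impI)
    \<comment> \<open>Nilpotency is known for some coordinates on \<open>E\<close>, so the existence proof uses those instead of \<open>\<kappa>\<close>.\<close>
    obtain \<kappa>0 s0 A0 p where \<kappa>0: "alg_iso E (Ga j d) \<kappa>0"
      and A0: "has_skew_matrix E d \<kappa>0 (\<Phi> t_var) s0 A0"
      and nil: "(A0 0 - theta j \<cdot>\<^sub>m 1\<^sub>m d) ^\<^sub>m p = 0\<^sub>m d d"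
      using assms(2) unfolding t_module_def by blast
    interpret P0: prolongation j d E \<kappa>0 \<Phi> k by (rule prolongation[OF \<kappa>0])
    have "is_prolongation j k E \<Phi> P0.N (Ga j P0.N) P0.\<Psi>"
      unfolding is_prolongation_def
      using P0.t_module_prolongation[OF A0 nil] P0.motive_iso_prolong[of P0.\<Psi>, OF P0.\<Psi>_t] by blast
    thus "\<exists>n (F :: ('q, 'k, 'k vec) alg_group) \<Psi>. is_prolongation j k E \<Phi> n F \<Psi>" by blast
  next
    fix n and F :: "('q, 'k, 'f) alg_group" and \<Psi>
    assume F: "is_prolongation j k E \<Phi> n F \<Psi>"
    interpret prolongation j d E \<kappa> \<Phi> k by (rule prolongation[OF assms(3)])
    show "n = d * (k + 1)"
      "\<exists>\<kappa>'. alg_iso F (Ga j (d * (k + 1))) \<kappa>' \<and>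
          has_skew_matrix F (d * (k + 1)) \<kappa>' (\<Psi> t_var) s (prolong_coeff k d A)"
      using prolongation_coordinates[OF assms(4) F] by (simp_all add: N_def)
  qed
qed

end
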